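(* Let $n,\ell\geq 1$ and $q,r\ge 0$ be integers. Let $I_1,\ldots,I_\ell$ be pairwise disjoint subsets of $[n]$, let $A_1,\ldots,A_q$ be pairwise disjoint subsets of $[n]$, and let $B_1,\ldots,B_r$ be pairwise disjoint subsets of $[n]$. For $\Delta\subset[\ell]$ let $I_\Delta=\cup_{t\in\Delta}I_t$, and let $L=|I_{[\ell]}|$. Let $\eta,x_0,y_0>0$ be real numbers, and let $Z_1,\ldots,Z_\ell$ be random variables on a common probability space such that for every $\Delta\subset[\ell]$ $$\mathbb{E}\left[\prod_{t\in\Delta}Z_t\right]=\eta^{|I_\Delta|}\ \prod_{j=1}^q\ \prod_{a=1}^{|I_\Delta\cap A_j|-1}\frac{1}{1-a x_0}\ \times\ \prod_{i=1}^r\ \prod_{a=1}^{|I_\Delta\cap B_i|-1}(1-a y_0),$$ where empty products are equal to $1$. Then: 1. When $r\geq1$, $2L^2y_0\leq1$ and $2x_0\leq y_0$, $$\left|\mathrm{cumul}(Z_1,\ldots,Z_\ell)\right|\leq 4\,\ell^{2\ell}\,\eta^{L}\,\left(L^2y_0\right)^{\ell-1}\left(\frac{x_0}{y_0}\right)^{cc(\mathcal{B})-1},$$ where $cc(\mathcal{B})$ is the number of connected components of the graph $\mathcal{B}$ with node set $[\ell]$ and with an edge between $t$ and $t'$ if and only if there exists $i\in[r]$ such that both $I_t$ and $I_{t'}$ intersect $B_i$. 2. When $r=0$ and $2L^2x_0\leq1$, $$\left|\mathrm{cumul}(Z_1,\ldots,Z_\ell)\right|\leq 2\,\ell^{2\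ell}\,\eta^{L}\,\left(L^2x_0\right)^{\ell-1}.$$
   Context: $[n]=\{1,\dots,n\}$. The joint cumulant of random variables $W_1,\dots,W_l$ is $\mathrm{cumul}(W_1,\ldots,W_l)=\sum_{G}(-1)^{|G|-1}(|G|-1)!\prod_{R\in G}\mathbb{E}\left[\prod_{i\in R}W_i\right]$, where the sum is over all partitions $G$ of $[l]$ (equivalently, the mixed partial derivative $\partial_{t_1}\cdots\partial_{t_l}$ at $0$ of the cumulant generating function $\log\mathbb{E}\exp(\sum_i t_iW_i)$). *)

theory Defs
  imports "HOL-Probability.Probability" "HOL-Library.Disjoint_Sets"
begin

definition joint_cumulant :: "'w measure \<Rightarrow> nat \<Rightarrow> (nat \<Rightarrow> 'w \<Rightarrow> real) \<Rightarrow> real" where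
  "joint_cumulant M l W =
     (\<Sum>G | partition_on {1..l} G.
        (-1) ^ (card G - 1) * fact (card G - 1) *
        (\<Prod>R\<in>G. prob_space.expectation M (\<lambda>\<omega>. \<Prod>i\<in>R. W i \<omega>)))"

(* The components of the graph with node set V and edge set E are the classes of the
   reachability relation on V; E is meant to be symmetric. Isolated nodes count. *)
definition num_components :: "'v set \<Rightarrow> ('v \<times> 'v) set \<Rightarrow> nat" where
  "num_components V E = card (V // (E \<inter> V \<times> V)\<^sup>*)"

definition sharing_edges ::
  "nat \<Rightarrow> nat \<Rightarrow> (nat \<Rightarrow> nat set) \<Rightarrow> (nat \<Rightarrow> nat set) \<Rightarrow> (nat \<times> nat) set" where
  "sharing_edges l r I B =
     {(t, t'). t \<in> {1..l} \<and> t' \<in> {1..l} \<and> t \<noteq> t' \<and>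
        (\<exists>i\<in>{1..r}. I t \<inter> B i \<noteq> {} \<and> I t' \<inter> B i \<noteq> {})}"

end

theory Submission
  imports Defs "HOL-Complex_Analysis.Complex_Analysis"
begin

text \<open>
  Up to the factor \<open>\<eta> ^ L\<close>, the moments are \<open>f(R) = (\<Prod>i. \<Prod>a. 1 - a y\<^sub>0) / (\<Prod>j. \<Prod>a. 1 - a x\<^sub>0)\<close>, where the number of
  factors of index \<open>i\<close> (or \<open>j\<close>) is additive in \<open>R\<close>. Substitute \<open>x\<^sub>0 = u v / L\<^sup>2\<close> and \<open>y\<^sub>0 = v / L\<^sup>2\<close> and let \<open>u\<close>, \<open>v\<close>
  range over the complex unit disc. There the products of moments, and hence the cumulant, are bounded, and
  the claim follows from the Schwarz lemma applied first in \<open>u\<close> and then in \<open>v\<close>, once the cumulant is known to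
  vanish to order \<open>cc - 1\<close> at \<open>u = 0\<close> and to order \<open>l - 1\<close> at \<open>v = 0\<close>.

  For these orders write \<open>f(R) = \<Prod>\<^bsub>D \<subseteq> R\<^esub> (1 + T D)\<close>. Introducing one factor \<open>1 + T D\<close> adds to the cumulant of \<open>S\<close> the
  term \<open>T D\<close> times the sum, over the partitions of \<open>S\<close> all of whose blocks meet \<open>D\<close>, of the products of the
  previous cumulants. Hence, for every map \<open>p\<close> on the indices, if each \<open>T D\<close> has order at least \<open>|p D| - 1\<close>, then
  the cumulant of each \<open>S\<close> has order at least \<open>|p S| - 1\<close>. One takes the identity for \<open>p\<close> in the variable \<open>v\<close>, and
  the map to connected components in the variable \<open>u\<close>. The order of \<open>T D = exp g - 1\<close> comes from the expansion of
  the logarithms: \<open>g\<close> is an alternating sum over the subsets of \<open>D\<close>, and the coefficient of the \<open>k\<close>-th power is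
  a \<open>|D|\<close>-fold finite difference of a polynomial of degree \<open>k + 1\<close>.
\<close>

section \<open>Cumulants and set partitions\<close>

text \<open>Removing a marked block \<open>b\<close> from a partition of \<open>S\<close> and
  inserting it again are inverse bijections between partitions with a marked block and pairs of a
  nonempty \<open>b\<close> and a partition of \<open>S - b\<close>.\<close>

lemma sum_partition_on_block:
  fixes F :: "'a set set \<Rightarrow> 'a set \<Rightarrow> 'b::comm_monoid_add"
  assumes "finite S"
  shows "(\<Sum>H | partition_on S H. \<Sum>b\<in>H. F H b) =
    (\<Sum>b | b \<subseteq> S \<and> b \<noteq> {}. \<Sum>G | partition_on (S - b) G. F (insert b G) b)"
proof -
  have "(\<Sum>H | partition_on S H. \<Sum>b\<in>H. F H b) = 
      (\<Sum>(H, b)\<in>(SIGMA H:{H. partition_on S H}. H). F H b)"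
    using assms by (intro sum.Sigma) (auto intro: finitely_many_partition_on finite_elements)
  also have "\<dots> = (\<Sum>(b, G)\<in>(SIGMA b:{b. b \<subseteq> S \<and> b \<noteq> {}}. {G. partition_on (S - b) G}). F (insert b G) b)"
  proof (rule sum.reindex_bij_witness[where i = "\<lambda>(b, G). (insert b G, b)" and j = "\<lambda>(H, b). (b, H - {b})"])
    fix x assume "x \<in> (SIGMA H:{H. partition_on S H}. H)"
    then obtain H b where x: "x = (H, b)" and H: "partition_on S H" and b: "b \<in> H" by auto
    show "(case case x of (H, b) \<Rightarrow> (b, H - {b}) of (b, G) \<Rightarrow> (insert b G, b)) = x"
      using b by (auto simp: x)
    have "disjnt b (\<Union>(H - {b}))"
      using H b by (auto simp: partition_on_def disjoint_def disjnt_def)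
    with partition_on_insert[of b "H - {b}" S]
    show "(case x of (H, b) \<Rightarrow> (b, H - {b})) \<in> (SIGMA b:{b. b \<subseteq> S \<and> b \<noteq> {}}. {G. partition_on (S - b) G})"
      using H b by (simp add: x insert_absorb)
    show "(case case x of (H, b) \<Rightarrow> (b, H - {b}) of (b, G) \<Rightarrow> F (insert b G) b) = (case x of (H, b) \<Rightarrow> F H b)"
      using b by (simp add: x insert_absorb)
  next
    fix x assume "x \<in> (SIGMA b:{b. b \<subseteq> S \<and> b \<noteq> {}}. {G. partition_on (S - b) G})"
    then obtain b G where x: "x = (b, G)" and b: "b \<subseteq> S" "b \<noteq> {}" and G: "partition_on (S - b) G" by auto
    have d: "disjnt b (\<Union>G)" using G by (auto simp: partition_on_def disjnt_def)
    from partition_on_insert[OF this] 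
    show "(case x of (b, G) \<Rightarrow> (insert b G, b)) \<in> (SIGMA H:{H. partition_on S H}. H)"
      using b G by (simp add: x)
    have "b \<notin> G" using d b by (auto simp: disjnt_def)
    then show "(case case x of (b, G) \<Rightarrow> (insert b G, b) of (H, b) \<Rightarrow> (b, H - {b})) = x"
      by (simp add: x)
  qed
  also have "\<dots> = (\<Sum>b | b \<subseteq> S \<and> b \<noteq> {}. \<Sum>G | partition_on (S - b) G. F (insert b G) b)"
    using assms by (intro sum.Sigma[symmetric]) (auto intro: finitely_many_partition_on)
  finally show ?thesis .
qed

text \<open>A partition splits uniquely into the blocks that meet \<open>D\<close> and those that do
  not; \<open>R\<close> is the union of the former, hence contains \<open>D\<close>.\<close>

lemma sum_partition_on_meeting:
  fixes F :: "'a set set \<Rightarrow> 'b::comm_monoid_add"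
  assumes "finite S" "D \<subseteq> S"
  shows "(\<Sum>H | partition_on S H. F H) =
    (\<Sum>R | D \<subseteq> R \<and> R \<subseteq> S. \<Sum>P | partition_on R P \<and> (\<forall>b\<in>P. b \<inter> D \<noteq> {}).
       \<Sum>Q | partition_on (S - R) Q. F (P \<union> Q))"
proof -
  let ?m = "\<lambda>H. {b\<in>H. b \<inter> D \<noteq> {}}"
  let ?X = "SIGMA R:{R. D \<subseteq> R \<and> R \<subseteq> S}. SIGMA P:{P. partition_on R P \<and> (\<forall>b\<in>P. b \<inter> D \<noteq> {})}.
     {Q. partition_on (S - R) Q}"
  have "(\<Sum>H | partition_on S H. F H) = (\<Sum>(R, P, Q)\<in>?X. F (P \<union> Q))"
  proof (rule sum.reindex_bij_witness[where i = "\<lambda>(R, P, Q). P \<union> Q" and j = "\<lambda>H. (\<Union>(?m H), ?m H, H - ?m H)"])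
    fix H assume "H \<in> {H. partition_on S H}"
    then have H: "\<Union>H = S" "disjoint H" "{} \<notin> H" by (auto simp: partition_on_def)
    have "D \<subseteq> \<Union>(?m H)" using H(1) assms(2) by fastforce
    moreover have "partition_on (S - \<Union>(?m H)) (H - ?m H)"
    proof (rule partition_onI)
      show "\<Union>(H - ?m H) = S - \<Union>(?m H)" using H(1,2) unfolding disjoint_def by (auto; blast)
    qed (use H in \<open>auto simp: disjoint_def disjnt_def\<close>)
    moreover have "partition_on (\<Union>(?m H)) (?m H)"
      using H by (auto simp: partition_on_def disjoint_def)
    ultimately show "(\<Union>(?m H), ?m H, H - ?m H) \<in> ?X" using H(1) by auto
  next
    fix x assume "x \<in> ?X"
    then obtain R P Q where x: "x = (R, P, Q)" and R: "D \<subseteq> R" "R \<subseteq> S" 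
      and P: "partition_on R P" "\<forall>b\<in>P. b \<inter> D \<noteq> {}" and Q: "partition_on (S - R) Q" by auto
    have m: "?m (P \<union> Q) = P" using P(2) Q R(1) by (auto simp: partition_on_def)
    have dis: "b \<inter> c = {}" if "b \<in> P" "c \<in> Q" for b c
      using that P(1) Q unfolding partition_on_def by blast
    have "P \<inter> Q = {}"
    proof (rule ccontr)
      assume "P \<inter> Q \<noteq> {}"
      then obtain b where "b \<in> P" "b \<in> Q" by auto
      with dis[of b b] P(1) show False by (simp add: partition_on_def)
    qed
    then show "(case case x of (R, P, Q) \<Rightarrow> P \<union> Q of H \<Rightarrow> (\<Union>(?m H), ?m H, H - ?m H)) = x"
      using m P(1) by (auto simp: x partition_on_def)
    have "partition_on S (P \<union> Q)"
    proof (rule partition_onI)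
      show "\<Union>(P \<union> Q) = S" using P(1) Q R by (auto simp: partition_on_def)
      show "{} \<notin> P \<union> Q" using P(1) Q by (simp add: partition_on_def)
      fix b c assume "b \<in> P \<union> Q" "c \<in> P \<union> Q" "b \<noteq> c"
      then show "disjnt b c"
        using dis P(1) Q unfolding partition_on_def disjoint_def disjnt_def by (metis Int_commute UnE)
    qed
    then show "(case x of (R, P, Q) \<Rightarrow> P \<union> Q) \<in> {H. partition_on S H}" by (simp add: x)
  qed (auto intro: arg_cong[where f = F])
  also have "\<dots> = (\<Sum>R | D \<subseteq> R \<and> R \<subseteq> S. \<Sum>(P, Q)\<in>(SIGMA P:{P. partition_on R P \<and> (\<forall>b\<in>P. b \<inter> D \<noteq> {})}.
     {Q. partition_on (S - R) Q}). F (P \<union> Q))"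
    using assms by (intro sum.Sigma[symmetric] ballI finite_SigmaI)
      (auto intro: finite_subset[OF _ finitely_many_partition_on] finite_subset)
  also have "\<dots> = (\<Sum>R | D \<subseteq> R \<and> R \<subseteq> S. \<Sum>P | partition_on R P \<and> (\<forall>b\<in>P. b \<inter> D \<noteq> {}).
       \<Sum>Q | partition_on (S - R) Q. F (P \<union> Q))"
    using assms by (intro sum.cong refl sum.Sigma[symmetric] ballI)
      (auto intro: finite_subset[OF _ finitely_many_partition_on] finite_subset)
  finally show ?thesis .
qed

text \<open>For \<open>D = {t}\<close> disjointness leaves exactly one block meeting
  \<open>D\<close>, so the inner partition \<open>P\<close> can only be \<open>{R}\<close>.\<close>

lemma sum_partition_on_containing:
  fixes F :: "'a set set \<Rightarrow> 'b::comm_monoid_add"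
  assumes "finite S" "t \<in> S"
  shows "(\<Sum>H | partition_on S H. F H) =
    (\<Sum>R | t \<in> R \<and> R \<subseteq> S. \<Sum>Q | partition_on (S - R) Q. F (insert R Q))"
proof -
  have "{P. partition_on R P \<and> (\<forall>b\<in>P. b \<inter> {t} \<noteq> {})} = {{R}}" if "t \<in> R" for R
  proof (intro set_eqI iffI)
    fix P assume "P \<in> {P. partition_on R P \<and> (\<forall>b\<in>P. b \<inter> {t} \<noteq> {})}"
    then have P: "\<Union>P = R" "disjoint P" "\<forall>b\<in>P. t \<in> b" by (auto simp: partition_on_def)
    obtain b where b: "b \<in> P" "t \<in> b" using P(1) \<open>t \<in> R\<close> by blast
    have "P = {b}" using b P(2,3) unfolding disjoint_def by blast
    then show "P \<in> {{R}}" using P(1) by auto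
  qed (use that in \<open>auto intro: partition_on_space\<close>)
  then show ?thesis
    using assms by (subst sum_partition_on_meeting[where D = "{t}"]) (auto intro!: sum.cong)
qed

text \<open>The formula of \<open>joint_cumulant\<close> for an arbitrary set function of moments.
  Random variables are abstracted away and the ring is left open, so that the moments may be
  continued to complex parameters.\<close>

definition cum :: "('a set \<Rightarrow> 'b::{comm_ring_1, ring_char_0}) \<Rightarrow> 'a set \<Rightarrow> 'b" where
  "cum f S = (\<Sum>G | partition_on S G. (-1) ^ (card G - 1) * fact (card G - 1) * (\<Prod>R\<in>G. f R))"

text \<open>The classical recursion between moments and cumulants. In a term with \<open>R\<close> a
  proper subset, \<open>f (S - R)\<close> supplies one more block not containing \<open>t\<close>,
  so these terms become a sum over partitions of \<open>S\<close> with a marked block avoiding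
  \<open>t\<close>.\<close>

lemma moment_recursion:
  assumes "finite S" "t \<in> S" "f {} = 1"
  shows "(\<Sum>R | t \<in> R \<and> R \<subseteq> S. cum f R * f (S - R)) = f S"
proof -
  let ?c = "\<lambda>k::nat. (-1) ^ (k - 1) * fact (k - 1) :: 'b"
  let ?W = "\<lambda>H. \<Prod>R\<in>H. f R"
  have S: "S \<noteq> {}" using assms by auto
  have fin: "finite {H. partition_on S H}" using assms by (intro finitely_many_partition_on)
  have "(\<Sum>R | t \<in> R \<and> R \<subset> S. cum f R * f (S - R)) =
      (\<Sum>b | b \<subseteq> S \<and> b \<noteq> {} \<and> t \<notin> b. cum f (S - b) * f b)"
    by (rule sum.reindex_bij_witness[where i = "\<lambda>b. S - b" and j = "\<lambda>b. S - b"]) 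
       (use assms in \<open>auto simp: double_diff\<close>)
  also have "\<dots> = (\<Sum>b | b \<subseteq> S \<and> b \<noteq> {}. \<Sum>G | partition_on (S - b) G.
      if t \<notin> b then ?c (card (insert b G) - 1) * ?W (insert b G) else 0)"
  proof (rule sum.mono_neutral_cong_left)
    fix b assume b: "b \<in> {b. b \<subseteq> S \<and> b \<noteq> {} \<and> t \<notin> b}"
    have "cum f (S - b) * f b = (\<Sum>G | partition_on (S - b) G. ?c (card G) * ?W G * f b)"
      by (simp add: cum_def sum_distrib_right)
    also have "\<dots> = (\<Sum>G | partition_on (S - b) G. ?c (card (insert b G) - 1) * ?W (insert b G))"
    proof (rule sum.cong[OF refl])
      fix G assume "G \<in> {G. partition_on (S - b) G}"
      then have G: "partition_on (S - b) G" by simp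
      have "finite G" using G assms by (meson finite_Diff finite_elements)
      moreover have "b \<notin> G" using b G by (auto simp: partition_on_def)
      ultimately show "?c (card G) * ?W G * f b = ?c (card (insert b G) - 1) * ?W (insert b G)"
        by (simp add: mult_ac)
    qed
    finally show "cum f (S - b) * f b = (\<Sum>G | partition_on (S - b) G.
      if t \<notin> b then ?c (card (insert b G) - 1) * ?W (insert b G) else 0)" using b by simp
  qed (use assms in auto)
  also have "\<dots> = (\<Sum>H | partition_on S H. \<Sum>b\<in>H. if t \<notin> b then ?c (card H - 1) * ?W H else 0)"
    using assms by (rule_tac sum_partition_on_block[symmetric]) 
  \<comment> \<open>exactly one block of \<open>H\<close> contains \<open>t\<close>; the recursion \<open>c (k + 1) = - k * c k\<close> then cancels all
    partitions except \<open>{S}\<close>\<close>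
  also have "\<dots> = (\<Sum>H | partition_on S H. of_nat (card H - 1) * (?c (card H - 1) * ?W H))"
  proof (rule sum.cong[OF refl])
    fix H assume "H \<in> {H. partition_on S H}"
    then have H: "partition_on S H" by simp
    have fH: "finite H" using H assms by (meson finite_elements)
    obtain b where b: "b \<in> H" "t \<in> b" using H assms by (auto simp: partition_on_def)
    have "{c \<in> H. t \<notin> c} = H - {b}" using b H unfolding partition_on_def disjoint_def by blast
    then have "card {c \<in> H. t \<notin> c} = card H - 1" using b fH by simp
    then show "(\<Sum>b\<in>H. if t \<notin> b then ?c (card H - 1) * ?W H else 0) = 
        of_nat (card H - 1) * (?c (card H - 1) * ?W H)"
      using fH by (simp add: sum.inter_filter[symmetric] del: One_nat_def)
  qed
  finally have proper: "(\<Sum>R | t \<in> R \<and> R \<subset> S. cum f R * f (S - R)) = 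
    (\<Sum>H | partition_on S H. of_nat (card H - 1) * (?c (card H - 1) * ?W H))" .
  have "{R. t \<in> R \<and> R \<subseteq> S} = insert S {R. t \<in> R \<and> R \<subset> S}" using assms by auto
  moreover have "finite {R. t \<in> R \<and> R \<subset> S}" 
    using assms by (auto intro: finite_subset[of _ "Pow S"])
  ultimately have "(\<Sum>R | t \<in> R \<and> R \<subseteq> S. cum f R * f (S - R)) = cum f S + 
      (\<Sum>R | t \<in> R \<and> R \<subset> S. cum f R * f (S - R))"
    by (simp add: assms)
  also have "\<dots> = (\<Sum>H | partition_on S H. ?c (card H) * ?W H + of_nat (card H - 1) * (?c (card H - 1) * ?W H))"
    unfolding proper by (simp add: cum_def sum.distrib)
  also have "\<dots> = (\<Sum>H | partition_on S H. if H = {S} then f S else 0)"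
  proof (rule sum.cong[OF refl])
    fix H assume "H \<in> {H. partition_on S H}"
    then have H: "partition_on S H" by simp
    have fH: "finite H" using H assms by (meson finite_elements)
    have "H \<noteq> {}" using H S by (auto simp: partition_on_def)
    then have pos: "card H \<noteq> 0" using fH by simp
    show "?c (card H) * ?W H + of_nat (card H - 1) * (?c (card H - 1) * ?W H) = (if H = {S} then f S else 0)"
    proof (cases "card H = 1")
      case True
      then have "H = {S}" using H by (auto simp: card_1_singleton_iff partition_on_def)
      then show ?thesis by simp
    next
      case False
      then obtain k where k: "card H = Suc (Suc k)" using pos by (metis One_nat_def old.nat.exhaust)
      then have "H \<noteq> {S}" by auto
      then show ?thesis by (simp add: k algebra_simps)
    qed
  qed
  also have "\<dots> = f S" using fin partition_on_space[OF S] by (simp add: sum.delta)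
  finally show ?thesis .
qed

text \<open>As \<open>f {} = 1\<close>, the term \<open>R = S\<close> of the recursion isolates the
  value at \<open>S\<close>, and induction on proper subsets identifies \<open>k\<close> with the
  cumulant. The point \<open>t\<close> may be chosen for each set separately, which allows a
  convenient choice when a candidate is verified.\<close>

lemma cum_unique:
  assumes "finite U" "f {} = 1"
    and k: "\<And>S. S \<subseteq> U \<Longrightarrow> S \<noteq> {} \<Longrightarrow> \<exists>t\<in>S. (\<Sum>R | t \<in> R \<and> R \<subseteq> S. k R * f (S - R)) = f S"
    and "S \<subseteq> U" "S \<noteq> {}"
  shows "cum f S = k S"
proof -
  have "finite S" using assms finite_subset by auto
  then show ?thesis using assms(4,5)
  proof (induction S rule: finite_psubset_induct)
    case (psubset S)
    obtain t where t: "t \<in> S" "(\<Sum>R | t \<in> R \<and> R \<subseteq> S. k R * f (S - R)) = f S"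
      using k psubset.prems by blast
    have "{R. t \<in> R \<and> R \<subseteq> S} = insert S {R. t \<in> R \<and> R \<subset> S}" using t by auto
    moreover have "finite {R. t \<in> R \<and> R \<subset> S}" 
      using psubset.hyps by (auto intro: finite_subset[of _ "Pow S"])
    ultimately have split: "(\<Sum>R | t \<in> R \<and> R \<subseteq> S. h R * f (S - R)) = h S + 
        (\<Sum>R | t \<in> R \<and> R \<subset> S. h R * f (S - R))" for h
      by (simp add: assms)
    have "(\<Sum>R | t \<in> R \<and> R \<subset> S. cum f R * f (S - R)) = (\<Sum>R | t \<in> R \<and> R \<subset> S. k R * f (S - R))"
    proof (rule sum.cong[OF refl])
      fix R assume "R \<in> {R. t \<in> R \<and> R \<subset> S}"
      then have "R \<subset> S" "R \<subseteq> U" "R \<noteq> {}" using psubset.prems by auto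
      then show "cum f R * f (S - R) = k R * f (S - R)" using psubset.IH by simp
    qed
    then show ?case
      using t(2) moment_recursion[where f = f, OF psubset.hyps t(1) assms(2)]
      unfolding split by (metis add_right_cancel)
  qed
qed

text \<open>Inverse formula, moments from cumulants: once the block \<open>R\<close> containing
  \<open>t\<close> is fixed, induction sums the rest to \<open>f (S - R)\<close>, and what remains
  is the recursion.\<close>

lemma sum_prod_cum:
  assumes "finite S" "f {} = 1"
  shows "(\<Sum>P | partition_on S P. \<Prod>R\<in>P. cum f R) = f S"
  using assms(1)
proof (induction S rule: finite_psubset_induct)
  case (psubset S)
  show ?case
  proof (cases "S = {}")
    case True
    then show ?thesis by (simp add: assms partition_on_empty)
  next
    case False
    then obtain t where t: "t \<in> S" by auto
    have "(\<Sum>P | partition_on S P. \<Prod>R\<in>P. cum f R) = 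
        (\<Sum>R | t \<in> R \<and> R \<subseteq> S. \<Sum>Q | partition_on (S - R) Q. \<Prod>B\<in>insert R Q. cum f B)"
      by (rule sum_partition_on_containing[OF psubset.hyps t])
    also have "\<dots> = (\<Sum>R | t \<in> R \<and> R \<subseteq> S. cum f R * f (S - R))"
    proof (rule sum.cong[OF refl])
      fix R assume R: "R \<in> {R. t \<in> R \<and> R \<subseteq> S}"
      have "(\<Prod>B\<in>insert R Q. cum f B) = cum f R * (\<Prod>B\<in>Q. cum f B)" if "partition_on (S - R) Q" for Q
      proof -
        have "R \<notin> Q" using R that by (auto simp: partition_on_def)
        moreover have "finite Q" using that psubset.hyps by (meson finite_Diff finite_elements)
        ultimately show ?thesis by simp
      qed
      then have "(\<Sum>Q | partition_on (S - R) Q. \<Prod>B\<in>insert R Q. cum f B) = 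
          cum f R * (\<Sum>Q | partition_on (S - R) Q. \<Prod>B\<in>Q. cum f B)"
        by (simp add: sum_distrib_left)
      also have "\<dots> = cum f R * f (S - R)"
        using R by (subst psubset.IH) auto
      finally show "(\<Sum>Q | partition_on (S - R) Q. \<Prod>B\<in>insert R Q. cum f B) = cum f R * f (S - R)" .
    qed
    finally show ?thesis using moment_recursion[where f = f, OF psubset.hyps t assms(2)] by simp
  qed
qed

text \<open>The right-hand side is checked against the recursion for the modified moments. This
  describes how cumulants react to a single factor \<open>1 + T\<close> attached to the sets
  containing \<open>D\<close>.\<close>

lemma cum_mult_indicator:
  assumes "finite S" "S \<noteq> {}" "D \<noteq> {}" "f {} = 1"
  shows "cum (\<lambda>R. if D \<subseteq> R then f R * (1 + T) else f R) S =
    cum f S + (if D \<subseteq> S then T * (\<Sum>P | partition_on S P \<and> (\<forall>b\<in>P. b \<inter> D \<noteq> {}). \<Prod>R\<in>P. cum f R) else 0)"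
proof (rule cum_unique[OF assms(1)])
  let ?W = "\<lambda>R. \<Sum>P | partition_on R P \<and> (\<forall>b\<in>P. b \<inter> D \<noteq> {}). \<Prod>R\<in>P. cum f R"
  let ?k = "\<lambda>R. cum f R + (if D \<subseteq> R then T * ?W R else 0)"
  let ?f = "\<lambda>R. if D \<subseteq> R then f R * (1 + T) else f R"
  fix S' assume S': "S' \<subseteq> S" "S' \<noteq> {}"
  have fin: "finite S'" using S' assms finite_subset by auto
  show "\<exists>t\<in>S'. (\<Sum>R | t \<in> R \<and> R \<subseteq> S'. ?k R * ?f (S' - R)) = ?f S'"
  proof (cases "D \<subseteq> S'")
    case False
    obtain t where t: "t \<in> S'" using S' by auto
    have "(\<Sum>R | t \<in> R \<and> R \<subseteq> S'. ?k R * ?f (S' - R)) = (\<Sum>R | t \<in> R \<and> R \<subseteq> S'. cum f R * f (S' - R))"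
      using False by (intro sum.cong refl) auto
    then show ?thesis using t False moment_recursion[where f = f, OF fin t assms(4)] by auto
  next
    case True
    \<comment> \<open>With \<open>t\<close> in \<open>D\<close>, the complement
      \<open>S' - R\<close> misses \<open>t\<close> and cannot contain \<open>D\<close>, so its
      moment is unmodified.\<close>
    obtain t where t: "t \<in> D" using assms by auto
    have fin': "finite {R. t \<in> R \<and> R \<subseteq> S'}" using fin by (auto intro: finite_subset[of _ "Pow S'"])
    have "(\<Sum>R | t \<in> R \<and> R \<subseteq> S'. ?k R * ?f (S' - R)) = 
        (\<Sum>R | t \<in> R \<and> R \<subseteq> S'. cum f R * f (S' - R) + (if D \<subseteq> R then T * ?W R * f (S' - R) else 0))"
      using t by (intro sum.cong refl) (auto simp: algebra_simps)
    also have "\<dots> = f S' + (\<Sum>R | t \<in> R \<and> R \<subseteq> S'. if D \<subseteq> R then T * ?W R * f (S' - R) else 0)"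
      using t True by (simp only: sum.distrib moment_recursion[where t = t and f = f] fin assms(4) subsetD)
    also have "(\<Sum>R | t \<in> R \<and> R \<subseteq> S'. if D \<subseteq> R then T * ?W R * f (S' - R) else 0) = 
       (\<Sum>R | D \<subseteq> R \<and> R \<subseteq> S'. T * ?W R * f (S' - R))"
      using fin' t by (intro sum.mono_neutral_cong_right) auto
    \<comment> \<open>Expanding \<open>f (S' - R)\<close> into cumulants supplies the blocks that
      avoid \<open>D\<close>; together with \<open>P\<close> these run through all partitions of
      \<open>S'\<close>, whose total is \<open>f S'\<close>.\<close>
    also have "\<dots> = (\<Sum>R | D \<subseteq> R \<and> R \<subseteq> S'. T * (\<Sum>P | partition_on R P \<and> (\<forall>b\<in>P. b \<inter> D \<noteq> {}).
       \<Sum>Q | partition_on (S' - R) Q. \<Prod>B\<in>P \<union> Q. cum f B))"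
    proof (rule sum.cong[OF refl])
      fix R assume R: "R \<in> {R. D \<subseteq> R \<and> R \<subseteq> S'}"
      have finR: "finite R" using R fin finite_subset by auto
      have "(\<Prod>B\<in>P \<union> Q. cum f B) = (\<Prod>B\<in>P. cum f B) * (\<Prod>B\<in>Q. cum f B)" 
        if P: "partition_on R P" and Q: "partition_on (S' - R) Q" for P Q
      proof (rule prod.union_disjoint)
        show "finite P" "finite Q" using P Q fin finR by (meson finite_Diff finite_elements)+
        show "P \<inter> Q = {}"
        proof (rule ccontr)
          assume "P \<inter> Q \<noteq> {}"
          then obtain b where b: "b \<in> P" "b \<in> Q" by auto
          have "b \<subseteq> R" "b \<subseteq> S' - R" using partition_onD1[OF P] partition_onD1[OF Q] b by blast+
          then have "b = {}" by blast
          with P b(1) show False by (simp add: partition_on_def)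
        qed
      qed
      then have "(\<Sum>P | partition_on R P \<and> (\<forall>b\<in>P. b \<inter> D \<noteq> {}).
         \<Sum>Q | partition_on (S' - R) Q. \<Prod>B\<in>P \<union> Q. cum f B) = 
        (\<Sum>P | partition_on R P \<and> (\<forall>b\<in>P. b \<inter> D \<noteq> {}). 
          (\<Prod>B\<in>P. cum f B) * (\<Sum>Q | partition_on (S' - R) Q. \<Prod>B\<in>Q. cum f B))"
        unfolding sum_distrib_left by (intro sum.cong refl) auto
      also have "\<dots> = ?W R * f (S' - R)"
        using fin sum_prod_cum[of "S' - R" f] assms(4) by (simp add: sum_distrib_right)
      finally show "T * ?W R * f (S' - R) = T * (\<Sum>P | partition_on R P \<and> (\<forall>b\<in>P. b \<inter> D \<noteq> {}).
         \<Sum>Q | partition_on (S' - R) Q. \<Prod>B\<in>P \<union> Q. cum f B)" 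
        by (simp add: mult.assoc)
    qed
    also have "\<dots> = T * f S'"
      using sum_prod_cum[where f = f, OF fin assms(4)] sum_partition_on_meeting[OF fin True, where F = "\<lambda>P. \<Prod>B\<in>P. cum f B"]
      by (simp flip: sum_distrib_left)
    finally show ?thesis using t True by (auto simp: algebra_simps)
  qed
qed (use assms in auto)

text \<open>The only singleton containing \<open>t\<close> is \<open>{t}\<close>, so the indicator
  of singletons solves the recursion. This is the start of the induction over the factors
  \<open>1 + T D\<close>.\<close>

lemma cum_const_one:
  assumes "finite S" "S \<noteq> {}"
  shows "cum (\<lambda>_. 1) S = (if card S = 1 then 1 else 0 :: 'b::{comm_ring_1, ring_char_0})"
proof (rule cum_unique[OF assms(1)])
  fix S' assume S': "S' \<subseteq> S" "S' \<noteq> {}"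
  have fin: "finite S'" using S' assms finite_subset by auto
  obtain t where t: "t \<in> S'" using S' by auto
  have "(\<Sum>R | t \<in> R \<and> R \<subseteq> S'. (if card R = 1 then 1 else 0) * (1::'b)) = 
      (\<Sum>R | t \<in> R \<and> R \<subseteq> S'. if R = {t} then 1 else 0)"
    by (intro sum.cong refl) (auto simp: card_1_singleton_iff)
  also have "\<dots> = 1" using fin t by (subst sum.delta) (auto intro: finite_subset[of _ "Pow S'"])
  finally show "\<exists>t\<in>S'. (\<Sum>R | t \<in> R \<and> R \<subseteq> S'. (if card R = 1 then 1 else 0) * (1::'b)) = 1"
    using t by auto
qed (use assms in auto)

section \<open>Order of vanishing of cumulants\<close>

lemma cum_cong:
  assumes "\<And>R. R \<subseteq> S \<Longrightarrow> R \<noteq> {} \<Longrightarrow> f R = g R"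
  shows "cum f S = cum g S"
  unfolding cum_def
proof (intro sum.cong refl arg_cong2[where f = "(*)"] prod.cong)
  fix G R assume "G \<in> {G. partition_on S G}" "R \<in> G"
  then have "R \<subseteq> S" "R \<noteq> {}" by (auto simp: partition_on_def)
  then show "f R = g R" by (rule assms)
qed

lemma bigo_power_mono:
  assumes "j \<le> k"
  shows "(\<lambda>z::complex. z ^ k) \<in> O[at 0](\<lambda>z. z ^ j)"
proof (rule landau_o.bigI[of 1])
  have "eventually (\<lambda>z::complex. norm z < 1) (at 0)"
    by (auto simp: eventually_at intro!: exI[of _ 1])
  then show "eventually (\<lambda>z::complex. norm (z ^ k) \<le> 1 * norm (z ^ j)) (at 0)"
    by eventually_elim (use assms in \<open>simp add: norm_power power_decreasing\<close>)
qed simp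

lemma bigo_powerI:
  assumes "f \<in> O[at 0](\<lambda>z::complex. z ^ k)" "j \<le> k"
  shows "f \<in> O[at 0](\<lambda>z. z ^ j)"
  using assms bigo_power_mono landau_o.big_trans by blast

text \<open>Every block shares a point with \<open>D\<close>, so at least one of its values under
  \<open>p\<close> is already attained on \<open>D\<close>, and the block adds at most one fewer
  than its number of values.\<close>

lemma card_image_meeting_le:
  assumes "partition_on S P" "\<And>B. B \<in> P \<Longrightarrow> B \<inter> D \<noteq> {}" "finite S" "D \<subseteq> S" "D \<noteq> {}"
  shows "card (p ` S) - 1 \<le> card (p ` D) - 1 + (\<Sum>B\<in>P. card (p ` B) - 1)"
proof -
  have finP: "finite P" using assms(1,3) by (rule finite_elements[rotated])
  have finB: "finite B" if "B \<in> P" for B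
    using that assms(1,3) partition_onD1[OF assms(1)] by (meson Union_upper finite_subset)
  have finD: "finite D" using assms finite_subset by blast
  have "p ` S \<subseteq> p ` D \<union> (\<Union>B\<in>P. p ` B - p ` D)" using partition_onD1[OF assms(1)] by auto
  then have "card (p ` S) \<le> card (p ` D \<union> (\<Union>B\<in>P. p ` B - p ` D))"
    using finP finB finD by (intro card_mono) auto
  also have "\<dots> \<le> card (p ` D) + card (\<Union>B\<in>P. p ` B - p ` D)" by (rule card_Un_le)
  also have "card (\<Union>B\<in>P. p ` B - p ` D) \<le> (\<Sum>B\<in>P. card (p ` B - p ` D))"
    using finP by (rule card_UN_le)
  also have "\<dots> \<le> (\<Sum>B\<in>P. card (p ` B) - 1)"
  proof (rule sum_mono)
    fix B assume B: "B \<in> P"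
    obtain t where t: "t \<in> B" "t \<in> D" using assms(2)[OF B] by auto
    have "card (p ` B - p ` D) \<le> card (p ` B - {p t})"
      using t finB[OF B] by (intro card_mono) auto
    also have "\<dots> = card (p ` B) - 1" using t by (intro card_Diff_singleton) auto
    finally show "card (p ` B - p ` D) \<le> card (p ` B) - 1" .
  qed
  finally have "card (p ` S) \<le> card (p ` D) + (\<Sum>B\<in>P. card (p ` B) - 1)" by simp
  moreover have "card (p ` D) \<noteq> 0" using finD assms(5) by simp
  ultimately show ?thesis by linarith
qed

text \<open>Factors are introduced one at a time. In the correction term the order of
  \<open>T D\<close> and the orders of the cumulants of the blocks add up, and the preceding count
  shows that the total suffices. The induction must cover all sets \<open>S\<close> at once, since
  it is applied to the blocks.\<close>

lemma cum_prod_bigo: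
  fixes T :: "complex \<Rightarrow> 'a set \<Rightarrow> complex"
  assumes "finite \<D>" "{} \<notin> \<D>"
    and "\<And>D. D \<in> \<D> \<Longrightarrow> (\<lambda>z. T z D) \<in> O[at 0](\<lambda>z. z ^ (card (p ` D) - 1))"
    and "finite S" "S \<noteq> {}"
  shows "(\<lambda>z. cum (\<lambda>R. \<Prod>D | D \<in> \<D> \<and> D \<subseteq> R. 1 + T z D) S) \<in> O[at 0](\<lambda>z. z ^ (card (p ` S) - 1))"
  using assms
proof (induction \<D> arbitrary: S rule: finite_induct)
  \<comment> \<open>All moments are 1, so the cumulant vanishes unless \<open>S\<close> is a
    singleton, for which the required order is 0.\<close>
  case empty
  then show ?case by (auto simp: cum_const_one card_1_singleton_iff)
next
  case (insert D \<D>)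
  let ?f = "\<lambda>z R. \<Prod>D | D \<in> \<D> \<and> D \<subseteq> R. 1 + T z D"
  have D: "D \<noteq> {}" using insert.prems by auto
  have IH: "(\<lambda>z. cum (?f z) R) \<in> O[at 0](\<lambda>z. z ^ (card (p ` R) - 1))" if "finite R" "R \<noteq> {}" for R
    using insert.IH insert.prems that by auto
  have "(\<Prod>E | E \<in> insert D \<D> \<and> E \<subseteq> R. 1 + T z E) = (if D \<subseteq> R then ?f z R * (1 + T z D) else ?f z R)" for z R
  proof (cases "D \<subseteq> R")
    case True
    then have "{E. E \<in> insert D \<D> \<and> E \<subseteq> R} = insert D {E \<in> \<D>. E \<subseteq> R}" by auto
    then show ?thesis using True insert.hyps by (simp add: mult.commute)
  next
    case False
    then have "{E. E \<in> insert D \<D> \<and> E \<subseteq> R} = {E \<in> \<D>. E \<subseteq> R}" by auto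
    then show ?thesis using False by simp
  qed
  moreover have "{E \<in> \<D>. E \<subseteq> {}} = {}" using insert.prems(1) by auto
  then have "?f z {} = 1" for z by (simp only: prod.empty)
  ultimately have eq: "cum (\<lambda>R. \<Prod>E | E \<in> insert D \<D> \<and> E \<subseteq> R. 1 + T z E) S = cum (?f z) S +
      (if D \<subseteq> S then T z D * (\<Sum>P | partition_on S P \<and> (\<forall>b\<in>P. b \<inter> D \<noteq> {}). \<Prod>R\<in>P. cum (?f z) R) else 0)" for z
    using cum_mult_indicator[OF insert.prems(3,4) D, of "?f z" "T z D"] by simp
  have "(\<lambda>z. T z D * (\<Sum>P | partition_on S P \<and> (\<forall>b\<in>P. b \<inter> D \<noteq> {}). \<Prod>R\<in>P. cum (?f z) R))
      \<in> O[at 0](\<lambda>z. z ^ (card (p ` S) - 1))" if "D \<subseteq> S"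
    unfolding sum_distrib_left
  proof (rule big_sum_in_bigo)
    fix P assume "P \<in> {P. partition_on S P \<and> (\<forall>b\<in>P. b \<inter> D \<noteq> {})}"
    then have P: "partition_on S P" "\<And>b. b \<in> P \<Longrightarrow> b \<inter> D \<noteq> {}" by auto
    have "(\<lambda>z. \<Prod>R\<in>P. cum (?f z) R) \<in> O[at 0](\<lambda>z. \<Prod>R\<in>P. z ^ (card (p ` R) - 1))"
    proof (rule landau_o.big_prod)
      fix R assume R: "R \<in> P"
      then have "R \<noteq> {}" "R \<subseteq> S" using P(1) by (auto simp: partition_on_def)
      then show "(\<lambda>z. cum (?f z) R) \<in> O[at 0](\<lambda>z. z ^ (card (p ` R) - 1))"
        using insert.prems(3) finite_subset by (intro IH) auto
    qed
    then have "(\<lambda>z. T z D * (\<Prod>R\<in>P. cum (?f z) R)) \<in> 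
        O[at 0](\<lambda>z. z ^ (card (p ` D) - 1) * (\<Prod>R\<in>P. z ^ (card (p ` R) - 1)))"
      using insert.prems(2) by (intro landau_o.big.mult) auto
    then have "(\<lambda>z. T z D * (\<Prod>R\<in>P. cum (?f z) R)) \<in> 
        O[at 0](\<lambda>z. z ^ (card (p ` D) - 1 + (\<Sum>R\<in>P. card (p ` R) - 1)))"
      by (simp add: power_sum power_add)
    then show "(\<lambda>z. T z D * (\<Prod>R\<in>P. cum (?f z) R)) \<in> O[at 0](\<lambda>z. z ^ (card (p ` S) - 1))"
      by (rule bigo_powerI) (rule card_image_meeting_le[OF P insert.prems(3) that D])
  qed
  then show ?case
    unfolding eq using IH[OF insert.prems(3,4)] by (cases "D \<subseteq> S") (auto intro: sum_in_bigo)
qed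

section \<open>Moebius inversion and exponentials\<close>

definition altsum :: "('a set \<Rightarrow> 'b::comm_ring_1) \<Rightarrow> 'a set \<Rightarrow> 'b" where
  "altsum h D = (\<Sum>E\<in>Pow D. (-1) ^ card E * h E)"

lemma norm_exp_minus_one_le:
  fixes w :: complex
  assumes "norm w \<le> C"
  shows "norm (exp w - 1) \<le> exp C * norm w"
proof -
  have "norm (exp w - exp 0) \<le> exp C * norm (w - 0)"
  proof (rule field_differentiable_bound[where S = "cball 0 C" and f' = exp])
    fix z :: complex assume "z \<in> cball 0 C"
    then have "Re z \<le> C" using complex_Re_le_cmod[of z] by simp
    then show "norm (exp z) \<le> exp C" by simp
  qed (use assms norm_ge_zero[of w] in \<open>auto intro!: derivative_eq_intros simp del: norm_ge_zero\<close>)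
  then show ?thesis by simp
qed

text \<open>Boundedness of \<open>g\<close> is enough, because \<open>exp\<close> is Lipschitz on
  bounded sets. Convergence to 0 cannot be expected when the required order is 0.\<close>

lemma exp_minus_one_bigo:
  fixes g :: "'x \<Rightarrow> complex"
  assumes "g \<in> O[F](w)" "g \<in> O[F](\<lambda>_. 1 :: complex)"
  shows "(\<lambda>x. exp (g x) - 1) \<in> O[F](w)"
proof -
  obtain C where C: "eventually (\<lambda>x. norm (g x) \<le> C * norm (1::complex)) F" using assms(2) by (rule landau_o.bigE)
  have "(\<lambda>x. exp (g x) - 1) \<in> O[F](g)"
  proof (rule landau_o.bigI[of "exp C"])
    show "eventually (\<lambda>x. norm (exp (g x) - 1) \<le> exp C * norm (g x)) F"
      using C by eventually_elim (simp add: norm_exp_minus_one_le)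
  qed simp
  then show ?thesis using assms(1) landau_o.big_trans by blast
qed

text \<open>Up to the sign \<open>(-1) ^ card D\<close>, \<open>altsum\<close> is the Moebius
  inverse of \<open>h\<close> over subsets. Summing it back over the nonempty subsets of
  \<open>R\<close> recovers \<open>h z R\<close>, so its exponential is a product of factors
  \<open>1 + T z D\<close>.\<close>

lemma cum_exp_bigo:
  fixes h :: "complex \<Rightarrow> 'a set \<Rightarrow> complex"
  assumes "finite S" "S \<noteq> {}" and h0: "\<And>z. h z {} = 0"
    and g: "\<And>D. D \<subseteq> S \<Longrightarrow> D \<noteq> {} \<Longrightarrow> (\<lambda>z. altsum (h z) D) \<in> O[at 0](\<lambda>z. z ^ (card (p ` D) - 1))"
  shows "(\<lambda>z. cum (\<lambda>R. exp (h z R)) S) \<in> O[at 0](\<lambda>z. z ^ (card (p ` S) - 1))"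
proof -
  define T where "T = (\<lambda>z D. exp ((-1) ^ card D * altsum (h z) D) - 1)"
  have "(\<lambda>z. cum (\<lambda>R. \<Prod>D | D \<in> Pow S - {{}} \<and> D \<subseteq> R. 1 + T z D) S) \<in> O[at 0](\<lambda>z. z ^ (card (p ` S) - 1))"
  proof (rule cum_prod_bigo)
    fix D assume D: "D \<in> Pow S - {{}}"
    then have g': "(\<lambda>z. (-1) ^ card D * altsum (h z) D) \<in> O[at 0](\<lambda>z. z ^ (card (p ` D) - 1))"
      using g by simp
    show "(\<lambda>z. T z D) \<in> O[at 0](\<lambda>z. z ^ (card (p ` D) - 1))"
      unfolding T_def using g' bigo_powerI[OF g', of 0] by (intro exp_minus_one_bigo) auto
  qed (use assms in auto)
  also have "(\<lambda>z. cum (\<lambda>R. \<Prod>D | D \<in> Pow S - {{}} \<and> D \<subseteq> R. 1 + T z D) S) = (\<lambda>z. cum (\<lambda>R. exp (h z R)) S)"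
  proof (intro ext cum_cong)
    fix z R assume R: "R \<subseteq> S" "R \<noteq> {}"
    then have fin: "finite R" using assms finite_subset by blast
    have "{D. D \<in> Pow S - {{}} \<and> D \<subseteq> R} = Pow R - {{}}" using R by auto
    then have "(\<Prod>D | D \<in> Pow S - {{}} \<and> D \<subseteq> R. 1 + T z D) = exp (\<Sum>D\<in>Pow R - {{}}. (-1) ^ card D * altsum (h z) D)"
      using fin by (simp add: T_def exp_sum)
    also have "(\<Sum>D\<in>Pow R - {{}}. (-1) ^ card D * altsum (h z) D) = (\<Sum>D\<in>Pow R. (-1) ^ card D * altsum (h z) D)"
      using fin h0 by (intro sum.mono_neutral_left) (auto simp: altsum_def)
    also have "\<dots> = h z R"
      by (rule inclusion_exclusion_symmetric[symmetric]) (use fin in \<open>auto simp: altsum_def\<close>)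
    finally show "(\<Prod>D | D \<in> Pow S - {{}} \<and> D \<subseteq> R. 1 + T z D) = exp (h z R)" .
  qed
  finally show ?thesis .
qed

section \<open>Iterated finite differences\<close>

lemma altsum_insert:
  assumes "finite D" "t \<notin> D"
  shows "altsum h (insert t D) = altsum (\<lambda>E. h E - h (insert t E)) D"
proof -
  \<comment> \<open>The subsets of \<open>insert t D\<close> are paired as \<open>E\<close> and
    \<open>insert t E\<close>. Hence each further element of \<open>D\<close> applies one more
    difference operator.\<close>
  have "altsum h (insert t D) = altsum h D + (\<Sum>E\<in>insert t ` Pow D. (-1) ^ card E * h E)"
    unfolding altsum_def Pow_insert using assms by (intro sum.union_disjoint) auto
  also have "(\<Sum>E\<in>insert t ` Pow D. (-1) ^ card E * h E) = (\<Sum>E\<in>Pow D. (-1) ^ card (insert t E) * h (insert t E))"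
    using assms by (subst sum.reindex) (auto simp: inj_on_def)
  also have "\<dots> = (\<Sum>E\<in>Pow D. - ((-1) ^ card E * h (insert t E)))"
  proof (rule sum.cong[OF refl])
    fix E assume "E \<in> Pow D"
    then have "finite E" "t \<notin> E" using assms finite_subset by auto
    then show "(-1) ^ card (insert t E) * h (insert t E) = - ((-1) ^ card E * h (insert t E))" by simp
  qed
  finally show ?thesis
    by (simp add: altsum_def sum_negf sum_subtractf right_diff_distrib)
qed

lemma altsum_sum: "altsum (\<lambda>E. \<Sum>i\<in>A. h i E) D = (\<Sum>i\<in>A. altsum (h i) D)"
  unfolding altsum_def sum_distrib_left by (rule sum.swap)

lemma altsum_mult_left: "altsum (\<lambda>E. c * h E) D = c * altsum h D"
  by (simp add: altsum_def sum_distrib_left mult.left_commute)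

lemma altsum_diff: "altsum (\<lambda>E. h E - k E) D = altsum h D - altsum k D"
  by (simp add: altsum_def right_diff_distrib sum_subtractf)

lemma altsum_add: "altsum (\<lambda>E. h E + k E) D = altsum h D + altsum k D"
  by (simp add: altsum_def distrib_left sum.distrib)

lemma altsum_cong: "(\<And>E. E \<subseteq> D \<Longrightarrow> h E = k E) \<Longrightarrow> altsum h D = altsum k D"
  by (auto simp: altsum_def intro!: sum.cong)

text \<open>More than \<open>k\<close> differences kill a polynomial of degree \<open>k\<close>.
  Adding \<open>t\<close> shifts \<open>b\<close> by \<open>m t\<close>; in the binomial expansion
  of the shifted power the terms below \<open>k\<close> vanish by induction, and the top term
  cancels against the unshifted power. The shift \<open>b\<close> is general for the sake of this
  induction.\<close>

lemma altsum_power: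
  fixes b :: "'b::comm_ring_1"
  assumes "finite D" "k < card D"
  shows "altsum (\<lambda>E. (of_nat (\<Sum>t\<in>E. m t) + b) ^ k) D = 0"
  using assms
proof (induction D arbitrary: k b rule: finite_induct)
  case (insert t D)
  let ?A = "\<lambda>k b. altsum (\<lambda>E. (of_nat (\<Sum>t\<in>E. m t) + b) ^ k) D"
  have ins: "(\<Sum>s\<in>insert t E. m s) = (\<Sum>s\<in>E. m s) + m t" if "E \<subseteq> D" for E
    using that insert.hyps finite_subset by (subst sum.insert) auto
  have "altsum (\<lambda>E. (of_nat (\<Sum>t\<in>E. m t) + b) ^ k) (insert t D) = ?A k b - ?A k (b + of_nat (m t))"
    unfolding altsum_insert[OF insert.hyps(1,2)] altsum_diff[symmetric]
    by (rule altsum_cong) (use ins in \<open>simp add: algebra_simps\<close>)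
  also have "?A k (b + of_nat (m t)) = altsum (\<lambda>E. \<Sum>i\<le>k. of_nat (k choose i) * of_nat (m t) ^ (k - i) * (of_nat (\<Sum>t\<in>E. m t) + b) ^ i) D"
    by (rule altsum_cong) (simp add: binomial_ring add.assoc[symmetric] mult_ac del: of_nat_sum)
  also have "\<dots> = (\<Sum>i\<le>k. of_nat (k choose i) * of_nat (m t) ^ (k - i) * ?A i b)"
    by (simp only: altsum_sum altsum_mult_left)
  also have "\<dots> = (\<Sum>i\<le>k. if i = k then ?A k b else 0)"
  proof (rule sum.cong[OF refl])
    fix i assume "i \<in> {..k}"
    then have "i \<noteq> k \<Longrightarrow> i < card D" using insert.prems insert.hyps by simp
    then show "of_nat (k choose i) * of_nat (m t) ^ (k - i) * ?A i b = (if i = k then ?A k b else 0)"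
      using insert.IH[of i b] by (simp del: of_nat_sum)
  qed
  finally show ?case by simp
qed simp

lemma sum_lessThan_add: "(\<Sum>a<n + c. f a) = (\<Sum>a<n. f a) + (\<Sum>a<c. f (n + a))" for f :: "nat \<Rightarrow> 'b::comm_monoid_add"
  by (induction c) (auto simp: add.assoc)

text \<open>The power sum is a polynomial of degree \<open>k + 1\<close> in its upper limit. Instead
  of an explicit formula for it, one difference is taken by hand: it leaves \<open>m t\<close>
  shifted \<open>k\<close>-th powers, which the remaining differences annihilate.\<close>

lemma altsum_sum_power:
  assumes "finite D" "k + 1 < card D"
  shows "altsum (\<lambda>E. \<Sum>a<(\<Sum>t\<in>E. m t). of_nat a ^ k) D = (0::'b::comm_ring_1)"
proof -
  obtain t where t: "t \<in> D" using assms by (metis card.empty ex_in_conv not_less_zero)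
  define D' where "D' = D - {t}"
  have D': "D = insert t D'" "t \<notin> D'" "finite D'" using t assms by (auto simp: D'_def)
  then have c: "k < card D'" using assms by simp
  have "altsum (\<lambda>E. \<Sum>a<(\<Sum>t\<in>E. m t). of_nat a ^ k) D = 
      altsum (\<lambda>E. \<Sum>a<m t. (-1) * (of_nat (\<Sum>t\<in>E. m t) + of_nat a) ^ k :: 'b) D'"
    unfolding D'(1) altsum_insert[OF D'(3,2)]
  proof (rule altsum_cong)
    fix E assume "E \<subseteq> D'"
    then have "(\<Sum>s\<in>insert t E. m s) = (\<Sum>s\<in>E. m s) + m t"
      using D' finite_subset by (subst sum.insert) auto
    then show "(\<Sum>a<(\<Sum>t\<in>E. m t). of_nat a ^ k) - (\<Sum>a<(\<Sum>t\<in>insert t E. m t). of_nat a ^ k) = 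
        (\<Sum>a<m t. (-1) * (of_nat (\<Sum>t\<in>E. m t) + of_nat a) ^ k :: 'b)"
      by (simp add: sum_lessThan_add sum_negf)
  qed
  also have "\<dots> = (\<Sum>a<m t. (-1) * altsum (\<lambda>E. (of_nat (\<Sum>t\<in>E. m t) + of_nat a) ^ k) D')"
    by (simp only: altsum_sum altsum_mult_left)
  also have "\<dots> = 0" by (simp add: altsum_power[OF D'(3) c] del: of_nat_sum)
  finally show ?thesis .
qed

text \<open>Adding or removing an element of weight 0 changes the sign but not the value, so the
  terms cancel in pairs.\<close>

lemma altsum_supported:
  assumes "finite D" "t \<in> D" "m t = 0"
  shows "altsum (\<lambda>E. q (\<Sum>t\<in>E. m t :: nat)) D = 0"
proof -
  define D' where "D' = D - {t}"
  have D': "D = insert t D'" "t \<notin> D'" "finite D'" using assms by (auto simp: D'_def)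
  have "altsum (\<lambda>E. q (\<Sum>t\<in>E. m t) - q (\<Sum>t\<in>insert t E. m t)) D' = altsum (\<lambda>_. 0) D'"
  proof (rule altsum_cong)
    fix E assume "E \<subseteq> D'"
    then have "(\<Sum>s\<in>insert t E. m s) = (\<Sum>s\<in>E. m s)"
      using D' assms finite_subset by (subst sum.insert) auto
    then show "q (\<Sum>t\<in>E. m t) - q (\<Sum>t\<in>insert t E. m t) = 0" by simp
  qed
  then show ?thesis unfolding D'(1) altsum_insert[OF D'(3,2)] by (simp add: altsum_def)
qed

section \<open>Expansion of the logarithms\<close>

lemma Ln_remainder_le:
  fixes w :: complex
  assumes "norm w \<le> 1 / 2"
  shows "norm (Ln (1 - w) + (\<Sum>i<K. w ^ i / of_nat i)) \<le> 2 * norm w ^ K"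
proof -
  \<comment> \<open>The term of index 0 is \<open>1 / 0 = 0\<close> up to sign, so the series and
    its truncation may both start at 0. The tail is dominated by a geometric series of ratio 1/2,
    which accounts for the constant 2.\<close>
  have "(\<lambda>n. - (w ^ n) / of_nat n) sums Ln (1 - w)"
    using Ln_series'[of "- w"] assms by simp
  from sums_split_initial_segment[OF this, of K]
  have s: "(\<lambda>n. - (w ^ (n + K)) / of_nat (n + K)) sums (Ln (1 - w) + (\<Sum>i<K. w ^ i / of_nat i))"
    by (simp add: sum_negf)
  have g: "(\<lambda>n. norm w ^ K * (1 / 2) ^ n) sums (norm w ^ K * (1 / (1 - 1 / 2)))"
    by (intro sums_mult geometric_sums) simp
  have "norm (Ln (1 - w) + (\<Sum>i<K. w ^ i / of_nat i)) \<le> norm w ^ K * (1 / (1 - 1 / 2))"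
  proof (rule norm_sums_le[OF s g])
    fix n
    have "norm (- (w ^ (n + K)) / of_nat (n + K)) \<le> norm w ^ (n + K)"
    proof (cases "n + K = 0")
      case False
      then have "1 \<le> real (n + K)" by linarith
      then have "norm w ^ (n + K) / real (n + K) \<le> norm w ^ (n + K) / 1"
        by (intro divide_left_mono) auto
      then show ?thesis by (simp add: norm_divide norm_power del: of_nat_add)
    qed simp
    also have "\<dots> = norm w ^ K * norm w ^ n" by (simp add: power_add)
    also have "\<dots> \<le> norm w ^ K * (1 / 2) ^ n"
      using assms by (intro mult_left_mono power_mono) auto
    finally show "norm (- (w ^ (n + K)) / of_nat (n + K)) \<le> norm w ^ K * (1 / 2) ^ n" .
  qed
  then show ?thesis by (simp add: mult.commute)
qed

lemma eventually_norm_mult_less: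
  fixes c :: complex
  assumes "e > 0"
  shows "eventually (\<lambda>z. norm (c * z) < e) (at 0)"
proof -
  have "((\<lambda>z. c * z) \<longlongrightarrow> c * 0) (at 0)" by (intro tendsto_intros)
  then show ?thesis using assms by (auto dest!: tendstoD[of _ _ _ e] simp: dist_norm)
qed

lemma Ln_remainder_bigo:
  "(\<lambda>z. Ln (1 - c * z) + (\<Sum>i<K. (c * z) ^ i / of_nat i)) \<in> O[at 0](\<lambda>z::complex. z ^ K)"
\<comment> \<open>The summand 1 keeps the constant positive when \<open>c = 0\<close>.\<close>
proof (rule landau_o.bigI[of "2 * (norm c ^ K + 1)"])
  show "eventually (\<lambda>z. norm (Ln (1 - c * z) + (\<Sum>i<K. (c * z) ^ i / of_nat i)) \<le> 2 * (norm c ^ K + 1) * norm (z ^ K)) (at 0)"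
    using eventually_norm_mult_less[of "1 / 2" c, simplified]
  proof eventually_elim
    case (elim z)
    then have "norm (Ln (1 - c * z) + (\<Sum>i<K. (c * z) ^ i / of_nat i)) \<le> 2 * norm (c * z) ^ K"
      by (intro Ln_remainder_le) simp
    also have "\<dots> \<le> 2 * (norm c ^ K + 1) * norm (z ^ K)"
      by (simp add: norm_mult norm_power power_mult_distrib distrib_right)
    finally show ?case .
  qed
  show "0 < 2 * (cmod c ^ K + 1)" by (simp add: add_nonneg_pos)
qed

text \<open>The logarithms are truncated below degree \<open>K = card D - 1\<close>. A power
  \<open>i < K\<close> satisfies \<open>i + 1 < card D\<close>, so its power sum has vanishing
  alternating sum, and only remainders of order \<open>K\<close> survive.\<close>

lemma altsum_Ln_bigo:
  assumes "finite D" "D \<noteq> {}"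
  shows "(\<lambda>z. altsum (\<lambda>E. \<Sum>a<(\<Sum>t\<in>E. m t). Ln (1 - of_nat a * (c * z))) D) \<in> 
    O[at 0](\<lambda>z. z ^ (card D - 1))"
proof -
  define K where "K = card D - 1"
  let ?R = "\<lambda>a z. Ln (1 - of_nat a * (c * z)) + (\<Sum>i<K. (of_nat a * (c * z)) ^ i / of_nat i)"
  have "altsum (\<lambda>E. \<Sum>a<(\<Sum>t\<in>E. m t). \<Sum>i<K. (of_nat a * (c * z)) ^ i / of_nat i) D = 0" for z
  proof -
    have "altsum (\<lambda>E. \<Sum>a<(\<Sum>t\<in>E. m t). \<Sum>i<K. (of_nat a * (c * z)) ^ i / of_nat i) D = 
        altsum (\<lambda>E. \<Sum>i<K. (c * z) ^ i / of_nat i * (\<Sum>a<(\<Sum>t\<in>E. m t). of_nat a ^ i)) D"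
      by (subst sum.swap) (simp add: sum_distrib_left sum_divide_distrib power_mult_distrib mult_ac)
    also have "\<dots> = (\<Sum>i<K. (c * z) ^ i / of_nat i * altsum (\<lambda>E. \<Sum>a<(\<Sum>t\<in>E. m t). of_nat a ^ i) D)"
      by (simp only: altsum_sum altsum_mult_left)
    also have "\<dots> = 0"
      using assms by (intro sum.neutral ballI) (simp add: altsum_sum_power K_def)
    finally show ?thesis .
  qed
  then have eq: "altsum (\<lambda>E. \<Sum>a<(\<Sum>t\<in>E. m t). Ln (1 - of_nat a * (c * z))) D =
      altsum (\<lambda>E. \<Sum>a<(\<Sum>t\<in>E. m t). ?R a z) D" for z
    by (simp add: sum.distrib altsum_add)
  have "(\<lambda>z. altsum (\<lambda>E. \<Sum>a<(\<Sum>t\<in>E. m t). ?R a z) D) \<in> O[at 0](\<lambda>z. z ^ K)"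
    unfolding altsum_def
  proof (intro big_sum_in_bigo)
    fix E
    have "(\<lambda>z. \<Sum>a<(\<Sum>t\<in>E. m t). ?R a z) \<in> O[at 0](\<lambda>z. z ^ K)"
      using Ln_remainder_bigo[of "of_nat _ * c" K] by (intro big_sum_in_bigo) (simp add: mult.assoc)
    then show "(\<lambda>z. (-1) ^ card E * (\<Sum>a<(\<Sum>t\<in>E. m t). ?R a z)) \<in> O[at 0](\<lambda>z. z ^ K)" by simp
  qed
  then show ?thesis unfolding eq K_def .
qed

text \<open>Either some weight on \<open>D\<close> is 0 and the alternating sum vanishes, or
  \<open>p\<close> is constant on \<open>D\<close> and the required order is 0. Thus terms that do
  not depend on \<open>z\<close> are admissible.\<close>

lemma altsum_supported_bigo:
  fixes q :: "nat \<Rightarrow> complex"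
  assumes "finite D" "D \<noteq> {}"
    and p: "\<And>s t. s \<in> D \<Longrightarrow> t \<in> D \<Longrightarrow> m s \<noteq> 0 \<Longrightarrow> m t \<noteq> 0 \<Longrightarrow> p s = p t"
  shows "(\<lambda>z. altsum (\<lambda>E. q (\<Sum>t\<in>E. m t)) D) \<in> O[at 0](\<lambda>z. z ^ (card (p ` D) - 1))"
proof (cases "\<exists>t\<in>D. m t = 0")
  case True
  then obtain t where "t \<in> D" "m t = 0" by auto
  then have "altsum (\<lambda>E. q (\<Sum>t\<in>E. m t)) D = 0" by (rule altsum_supported[OF assms(1)])
  then show ?thesis by simp
next
  case False
  then have "p s = p t" if "s \<in> D" "t \<in> D" for s t
    using False that by (intro p) auto
  moreover obtain t where "t \<in> D" using assms by auto
  ultimately have "p ` D \<subseteq> {p t}" by blast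
  then have "card (p ` D) \<le> 1" using card_mono[of "{p t}" "p ` D"] by simp
  then show ?thesis by simp
qed

section \<open>Cumulants of the moment ratios\<close>

text \<open>The factor for \<open>a = 0\<close> is \<open>1\<close>; including it avoids the truncated subtraction \<open>card \<dots> - 1\<close>.\<close>

definition falling :: "('a \<Rightarrow> nat) \<Rightarrow> 'b::comm_ring_1 \<Rightarrow> 'a set \<Rightarrow> 'b" where
  "falling m x R = (\<Prod>a<(\<Sum>t\<in>R. m t). 1 - of_nat a * x)"

text \<open>The weights \<open>m j t\<close> and \<open>k i t\<close> stand for the cardinalities of
  the intersections of \<open>I t\<close> with \<open>A j\<close> and \<open>B i\<close>; they add
  up over \<open>R\<close> because the sets \<open>I t\<close> are disjoint. The field is left open
  since both real and complex parameters occur.\<close>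

definition moment_ratio ::
  "'j set \<Rightarrow> ('j \<Rightarrow> 'a \<Rightarrow> nat) \<Rightarrow> 'i set \<Rightarrow> ('i \<Rightarrow> 'a \<Rightarrow> nat) \<Rightarrow> 'b \<Rightarrow> 'b \<Rightarrow> 'a set \<Rightarrow> 'b::field" where
  "moment_ratio J m K k x y R = (\<Prod>i\<in>K. falling (k i) y R) / (\<Prod>j\<in>J. falling (m j) x R)"

text \<open>Near 0 none of the factors vanishes, so the ratio is the exponential of a signed sum of
  logarithms. For \<open>\<beta>\<close> only the factors that occur are constrained, as
  \<open>\<beta>\<close> may be a nonzero constant.\<close>

lemma cum_moment_ratio_bigo:
  fixes \<alpha> \<beta> :: "complex \<Rightarrow> complex"
  assumes S: "finite S" "S \<noteq> {}"
    and A: "\<And>a. eventually (\<lambda>z. of_nat a * \<alpha> z \<noteq> 1) (at 0)"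
    and B: "\<And>i a. i \<in> K \<Longrightarrow> a < (\<Sum>t\<in>S. k i t) \<Longrightarrow> eventually (\<lambda>z. of_nat a * \<beta> z \<noteq> 1) (at 0)"
    and fin: "finite K"
    and ordA: "\<And>D j. D \<subseteq> S \<Longrightarrow> D \<noteq> {} \<Longrightarrow> 
      (\<lambda>z. altsum (\<lambda>E. \<Sum>a<(\<Sum>t\<in>E. m j t). Ln (1 - of_nat a * \<alpha> z)) D) \<in> O[at 0](\<lambda>z. z ^ (card (p ` D) - 1))"
    and ordB: "\<And>D i. D \<subseteq> S \<Longrightarrow> D \<noteq> {} \<Longrightarrow> i \<in> K \<Longrightarrow>
      (\<lambda>z. altsum (\<lambda>E. \<Sum>a<(\<Sum>t\<in>E. k i t). Ln (1 - of_nat a * \<beta> z)) D) \<in> O[at 0](\<lambda>z. z ^ (card (p ` D) - 1))"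
  shows "(\<lambda>z. cum (moment_ratio J m K k (\<alpha> z) (\<beta> z)) S) \<in> O[at 0](\<lambda>z. z ^ (card (p ` S) - 1))"
proof -
  let ?ln = "\<lambda>x w R. \<Sum>a<(\<Sum>t\<in>R. w t). Ln (1 - of_nat a * x)"
  define h where "h = (\<lambda>z R. (\<Sum>i\<in>K. ?ln (\<beta> z) (k i) R) - (\<Sum>j\<in>J. ?ln (\<alpha> z) (m j) R))"
  have ord: "(\<lambda>z. cum (\<lambda>R. exp (h z R)) S) \<in> O[at 0](\<lambda>z. z ^ (card (p ` S) - 1))"
  proof (rule cum_exp_bigo[OF S])
    fix D assume D: "D \<subseteq> S" "D \<noteq> {}"
    have eq: "altsum (h z) D = (\<Sum>i\<in>K. altsum (?ln (\<beta> z) (k i)) D) - (\<Sum>j\<in>J. altsum (?ln (\<alpha> z) (m j)) D)" for z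
      by (simp only: h_def altsum_diff altsum_sum)
    show "(\<lambda>z. altsum (h z) D) \<in> O[at 0](\<lambda>z. z ^ (card (p ` D) - 1))"
      unfolding eq by (intro sum_in_bigo big_sum_in_bigo ordA ordB D)
  qed (simp add: h_def)
  define N where "N = (\<Sum>j\<in>J. \<Sum>t\<in>S. m j t)"
  have exp_ln: "exp (?ln x w R) = falling w x R" 
    if "\<And>a. a < (\<Sum>t\<in>S. w t) \<Longrightarrow> of_nat a * x \<noteq> 1" "R \<subseteq> S" for x w R
  proof -
    have "(\<Sum>t\<in>R. w t) \<le> (\<Sum>t\<in>S. w t)" using that S by (intro sum_mono2) auto
    then have "a < (\<Sum>t\<in>R. w t) \<Longrightarrow> exp (Ln (1 - of_nat a * x)) = 1 - of_nat a * x" for a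
      using that(1)[of a] by (intro exp_Ln) auto
    then show ?thesis by (simp add: falling_def exp_sum)
  qed
  have "eventually (\<lambda>z. \<forall>a\<in>{..<N}. of_nat a * \<alpha> z \<noteq> 1) (at 0)"
    using A by (simp add: eventually_ball_finite_distrib)
  moreover have "eventually (\<lambda>z. \<forall>i\<in>K. \<forall>a\<in>{..<(\<Sum>t\<in>S. k i t)}. of_nat a * \<beta> z \<noteq> 1) (at 0)"
    using B fin by (simp add: eventually_ball_finite_distrib)
  ultimately have ev: "eventually (\<lambda>z. cum (\<lambda>R. exp (h z R)) S = cum (moment_ratio J m K k (\<alpha> z) (\<beta> z)) S) (at 0)"
  proof eventually_elim
    case (elim z)
    show ?case
    proof (rule cum_cong)
      fix R assume R: "R \<subseteq> S"
      have "exp (h z R) = (\<Prod>i\<in>K. exp (?ln (\<beta> z) (k i) R)) / exp (\<Sum>j\<in>J. ?ln (\<alpha> z) (m j) R)"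
        using fin by (simp add: h_def exp_diff exp_sum)
      also have "(\<Prod>i\<in>K. exp (?ln (\<beta> z) (k i) R)) = (\<Prod>i\<in>K. falling (k i) (\<beta> z) R)"
        using elim(2) R by (intro prod.cong refl exp_ln) auto
      also have "exp (\<Sum>j\<in>J. ?ln (\<alpha> z) (m j) R) = (\<Prod>j\<in>J. falling (m j) (\<alpha> z) R)"
      proof (cases "finite J")
        case True
        have "(\<Sum>t\<in>S. m j t) \<le> N" if "j \<in> J" for j
          using True that unfolding N_def by (intro member_le_sum) auto
        then have "(\<Prod>j\<in>J. exp (?ln (\<alpha> z) (m j) R)) = (\<Prod>j\<in>J. falling (m j) (\<alpha> z) R)"
          using elim(1) R by (intro prod.cong refl exp_ln) fastforce+
        then show ?thesis using True by (simp add: exp_sum)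
      qed simp
      finally show "exp (h z R) = moment_ratio J m K k (\<alpha> z) (\<beta> z) R" by (simp add: moment_ratio_def)
    qed
  qed
  show ?thesis using ord unfolding landau_o.big.in_cong[OF ev] .
qed

lemma eventually_of_nat_mult_neq_1:
  "eventually (\<lambda>z. of_nat a * (c * z :: complex) \<noteq> 1) (at 0)"
  using eventually_norm_mult_less[of 1 "of_nat a * c"] 
  by (auto elim!: eventually_mono simp: mult.assoc)

text \<open>The order in the common scale \<open>v\<close> of both parameters: here \<open>p\<close>
  is the identity, and the expansion of the logarithms serves numerator and denominator
  alike.\<close>

lemma cum_moment_ratio_bigo_scaled:
  assumes "finite S" "S \<noteq> {}" "finite K"
  shows "(\<lambda>z. cum (moment_ratio J m K k (c * z) (d * z)) S) \<in> O[at 0](\<lambda>z::complex. z ^ (card S - 1))"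
proof -
  have "(\<lambda>z. altsum (\<lambda>E. \<Sum>a<(\<Sum>t\<in>E. w t). Ln (1 - of_nat a * (c * z))) D)
      \<in> O[at 0](\<lambda>z. z ^ (card ((\<lambda>x. x) ` D) - 1))" if "D \<subseteq> S" "D \<noteq> {}" for c D w
    using altsum_Ln_bigo[of D, where m = w and c = c] that assms finite_subset by auto
  then show ?thesis
    using assms cum_moment_ratio_bigo[where p = "\<lambda>x. x" and S = S and \<alpha> = "\<lambda>z. c * z" and \<beta> = "\<lambda>z. d * z" and K = K and k = k and m = m and J = J]
    by (auto intro: eventually_of_nat_mult_neq_1)
qed

text \<open>The order in the ratio \<open>u\<close> of the two parameters. The denominators depend
  on \<open>z\<close> and have order \<open>card D - 1\<close>, which is enough as \<open>p\<close>
  can only merge points. The numerators are constant in \<open>z\<close>, and the support condition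
  on \<open>k\<close> handles them.\<close>

lemma cum_moment_ratio_bigo_components:
  assumes S: "finite S" "S \<noteq> {}" "finite K"
    and d: "\<And>i a. i \<in> K \<Longrightarrow> a < (\<Sum>t\<in>S. k i t) \<Longrightarrow> of_nat a * d \<noteq> 1"
    and p: "\<And>i s t. i \<in> K \<Longrightarrow> s \<in> S \<Longrightarrow> t \<in> S \<Longrightarrow> k i s \<noteq> 0 \<Longrightarrow> k i t \<noteq> 0 \<Longrightarrow> p s = p t"
  shows "(\<lambda>z. cum (moment_ratio J m K k (c * z) d) S) \<in> O[at 0](\<lambda>z::complex. z ^ (card (p ` S) - 1))"
proof (rule cum_moment_ratio_bigo[where \<alpha> = "\<lambda>z. c * z" and \<beta> = "\<lambda>_. d", OF S(1,2) _ _ S(3)])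
  fix D j assume D: "D \<subseteq> S" "D \<noteq> {}"
  then have "finite D" using S finite_subset by auto
  then show "(\<lambda>z. altsum (\<lambda>E. \<Sum>a<(\<Sum>t\<in>E. m j t). Ln (1 - of_nat a * (c * z))) D)
      \<in> O[at 0](\<lambda>z. z ^ (card (p ` D) - 1))"
    using D by (intro bigo_powerI[OF altsum_Ln_bigo]) (auto simp: card_image_le diff_le_mono)
next
  fix D i assume D: "D \<subseteq> S" "D \<noteq> {}" and i: "i \<in> K"
  show "(\<lambda>z. altsum (\<lambda>E. \<Sum>a<(\<Sum>t\<in>E. k i t). Ln (1 - of_nat a * d)) D)
      \<in> O[at 0](\<lambda>z. z ^ (card (p ` D) - 1))"
  proof (rule altsum_supported_bigo[where q = "\<lambda>n. \<Sum>a<n. Ln (1 - of_nat a * d)"])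
    show "finite D" using D S(1) finite_subset by auto
    fix s t assume "s \<in> D" "t \<in> D" "k i s \<noteq> 0" "k i t \<noteq> 0"
    then show "p s = p t" using D by (intro p[OF i]) auto
  qed fact
next
  fix i a assume "i \<in> K" "a < (\<Sum>t\<in>S. k i t)"
  then show "eventually (\<lambda>z::complex. of_nat a * d \<noteq> 1) (at 0)" using d by simp
qed (rule eventually_of_nat_mult_neq_1)

section \<open>The Schwarz lemma for a zero of order k\<close>

lemma Schwarz_power:
  assumes "f holomorphic_on ball 0 1" "continuous_on (cball 0 1) f"
    and le: "\<And>z. norm z \<le> 1 \<Longrightarrow> norm (f z) \<le> C"
    and O: "f \<in> O[at 0](\<lambda>z. z ^ k)" and z: "norm z \<le> 1"
  shows "norm (f z) \<le> C * norm z ^ k"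
proof (cases "norm z = 1")
  case True
  then show ?thesis using le[of z] by simp
next
  case False
  with z have z: "norm z < 1" by simp
  \<comment> \<open>The order of \<open>f\<close> bounds the quotient near 0, so its singularity
    there is removable.\<close>
  have "(\<lambda>z. f z / z ^ k) holomorphic_on ball 0 1 - {0}"
    using assms(1) by (intro holomorphic_intros holomorphic_on_subset[OF assms(1)]) auto
  moreover obtain B where "eventually (\<lambda>z. norm (f z) \<le> B * norm (z ^ k)) (at 0)"
    using O by (rule landau_o.bigE)
  then have "eventually (\<lambda>z. norm (f z / z ^ k) \<le> B) (at 0)"
    using eventually_neq_at_within[of 0 0 UNIV]
    by eventually_elim (simp add: norm_divide field_simps)
  ultimately obtain g where g: "g holomorphic_on ball 0 1" "\<And>z. z \<in> ball 0 1 - {0} \<Longrightarrow> g z = f z / z ^ k"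
    using holomorphic_on_extend_bounded[of "\<lambda>z. f z / z ^ k" "ball 0 1" 0] by auto
  have fg: "f w = w ^ k * g w" if "norm w < 1" for w
  \<comment> \<open>The defining equation of \<open>g\<close> says nothing at 0; there the identity
    follows by passing to the limit.\<close>
  proof (cases "w = 0")
    case False
    then show ?thesis using g(2)[of w] that by simp
  next
    case True
    have "isCont f 0" "isCont g 0"
      using assms(1) g(1) by (auto dest!: holomorphic_on_imp_continuous_on simp: continuous_on_eq_continuous_at)
    then have lim: "(f \<longlongrightarrow> f 0) (at 0)" "((\<lambda>w. w ^ k * g w) \<longlongrightarrow> 0 ^ k * g 0) (at 0)"
      unfolding isCont_def by (auto intro!: tendsto_mult tendsto_power tendsto_ident_at)
    have "eventually (\<lambda>w::complex. w \<in> ball 0 1 - {0}) (at 0)"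
      by (auto simp: eventually_at intro!: exI[of _ 1])
    then have "eventually (\<lambda>w. f w = w ^ k * g w) (at 0)"
      by eventually_elim (use g(2) in auto)
    from tendsto_cong[OF this] lim have "f 0 = 0 ^ k * g 0"
      using LIM_unique by blast
    then show ?thesis using True by simp
  qed
  \<comment> \<open>On the circle of radius \<open>r < 1\<close> the bound on \<open>f\<close> gives
    \<open>C / r ^ k\<close> for \<open>g\<close>. The maximum modulus principle carries it to
    \<open>z\<close>, and then \<open>r\<close> tends to 1.\<close>
  have "norm (g z) \<le> C"
  proof (rule field_le_epsilon)
    fix e :: real assume e: "e > 0"
    have "((\<lambda>r. C / r ^ k) \<longlongrightarrow> C / 1 ^ k) (at_left (1::real))" by (intro tendsto_intros) auto
    then have "eventually (\<lambda>r. C / r ^ k < C + e) (at_left (1::real))"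
      using e by (intro order_tendstoD(2)) auto
    moreover have "eventually (\<lambda>r. norm z < r \<and> 0 < r \<and> r < 1) (at_left (1::real))"
      using z eventually_at_left_real[of "norm z" 1] by (auto elim!: eventually_mono intro: le_less_trans[OF norm_ge_zero])
    ultimately have "eventually (\<lambda>r. C / r ^ k < C + e \<and> norm z < r \<and> 0 < r \<and> r < 1) (at_left (1::real))"
      by (rule eventually_conj)
    then obtain r where r: "C / r ^ k < C + e" "norm z < r" "0 < r" "r < 1"
      using eventually_happens[of _ "at_left (1::real)"] by auto
    have "norm (g z) \<le> C / r ^ k"
    proof (rule maximum_modulus_frontier[where S = "cball 0 r" and f = g and B = "C / r ^ k"])
      show "g holomorphic_on interior (cball 0 r)" "continuous_on (closure (cball 0 r)) g"
        using g(1) r by (auto intro!: holomorphic_on_subset[OF g(1)] holomorphic_on_imp_continuous_on)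
      fix w :: complex assume "w \<in> frontier (cball 0 r)"
      then have w: "norm w = r" by (simp add: frontier_cball)
      then have "r ^ k * norm (g w) \<le> C" using le[of w] fg[of w] r by (simp add: norm_mult norm_power)
      then show "norm (g w) \<le> C / r ^ k" using r by (simp add: field_simps)
    qed (use r in auto)
    with r show "norm (g z) \<le> C + e" by linarith
  qed
  then show ?thesis using fg[OF z] by (simp add: norm_mult norm_power mult.commute mult_right_mono)
qed

section \<open>Bounds over the complex disc\<close>

lemma sum_lessThan_le_square: "(\<Sum>a<n. real a) \<le> (real n)\<^sup>2 / 2"
  by (induction n) (auto simp: power2_eq_square field_simps)

text \<open>From \<open>(a - 1)\<^sup>2 \<ge> 0\<close> one gets
  \<open>4 * a \<le> (a + 1)\<^sup>2\<close>. The factor 4 keeps all \<open>1 - a * x\<close> away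
  from 0, even on a disc of twice the radius.\<close>

lemma four_mult_less_le_1:
  assumes "a < n" "X * (real n)\<^sup>2 \<le> 1" "0 \<le> X"
  shows "4 * (real a * X) \<le> 1"
proof -
  have "4 * real a \<le> (real a + 1)\<^sup>2" using zero_le_power2[of "real a - 1"] by (simp add: power2_eq_square algebra_simps)
  also have "\<dots> \<le> (real n)\<^sup>2" using assms(1) by (intro power_mono) auto
  finally have "4 * real a * X \<le> (real n)\<^sup>2 * X" using assms(3) by (rule mult_right_mono)
  then show ?thesis using assms(2) by (simp add: mult_ac)
qed

lemma norm_falling_le:
  fixes x :: complex
  assumes "norm x \<le> X"
  shows "norm (falling w x R) \<le> exp (X * (real (\<Sum>t\<in>R. w t))\<^sup>2 / 2)"
proof -
  let ?n = "\<Sum>t\<in>R. w t"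
  have X: "0 \<le> X" using assms norm_ge_zero order_trans by blast
  have "norm (1 - of_nat a * x) \<le> exp (real a * X)" for a
  proof -
    have "norm (1 - of_nat a * x) \<le> 1 + real a * norm x"
      using norm_triangle_ineq4[of 1 "of_nat a * x"] by (simp add: norm_mult)
    also have "\<dots> \<le> 1 + real a * X" using assms by (simp add: mult_left_mono)
    also have "\<dots> \<le> exp (real a * X)" by (rule exp_ge_add_one_self)
    finally show ?thesis .
  qed
  then have "norm (falling w x R) \<le> (\<Prod>a<?n. exp (real a * X))"
    unfolding falling_def prod_norm[symmetric] by (intro prod_mono) auto
  also have "\<dots> = exp ((\<Sum>a<?n. real a) * X)" by (simp add: exp_sum[symmetric] sum_distrib_right)
  also have "\<dots> \<le> exp (X * (real ?n)\<^sup>2 / 2)"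
    using mult_right_mono[OF sum_lessThan_le_square[of ?n] X] by (simp add: mult_ac)
  finally show ?thesis .
qed

lemma norm_inverse_falling_le:
  fixes x :: complex
  assumes "norm x \<le> X" and "\<And>a. a < (\<Sum>t\<in>R. w t) \<Longrightarrow> 4 * (real a * X) \<le> 1"
  shows "norm (1 / falling w x R) \<le> exp (2 / 3 * (X * (real (\<Sum>t\<in>R. w t))\<^sup>2))"
proof -
  let ?n = "\<Sum>t\<in>R. w t"
  have X: "0 \<le> X" using assms(1) norm_ge_zero order_trans by blast
  have "norm (1 / (1 - of_nat a * x)) \<le> exp (4 / 3 * (real a * X))" if "a < ?n" for a
  proof -
    let ?s = "real a * X"
    have s: "0 \<le> ?s" "4 * ?s \<le> 1" using X assms(2)[OF that] by auto
    \<comment> \<open>The product equals \<open>1 + s * (1 - 4 * s) / 3\<close>, hence is at least 1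
      for \<open>0 \<le> s \<le> 1 / 4\<close>. The rate 4/3 then becomes 2/3, since the indices
      below \<open>n\<close> sum to at most half of \<open>n\<^sup>2\<close>.\<close>
    have "1 \<le> (1 + 4 / 3 * ?s) * (1 - ?s)"
      using mult_left_mono[OF s(2,1)] by (simp add: algebra_simps)
    also have "\<dots> \<le> exp (4 / 3 * ?s) * (1 - ?s)"
      using s exp_ge_add_one_self[of "4 / 3 * ?s"] by (intro mult_right_mono) auto
    also have "\<dots> \<le> exp (4 / 3 * ?s) * norm (1 - of_nat a * x)"
    proof (rule mult_left_mono)
      have "1 - real a * norm x \<le> norm (1 - of_nat a * x)"
        using norm_triangle_ineq2[of 1 "of_nat a * x"] by (simp add: norm_mult)
      moreover have "real a * norm x \<le> ?s" using assms(1) by (simp add: mult_left_mono)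
      ultimately show "1 - ?s \<le> norm (1 - of_nat a * x)" by linarith
    qed simp
    finally have le: "1 \<le> exp (4 / 3 * ?s) * norm (1 - of_nat a * x)" .
    then have "norm (1 - of_nat a * x) \<noteq> 0" by auto
    then have "0 < norm (1 - of_nat a * x)" by simp
    with le show ?thesis by (simp add: norm_divide divide_le_eq)
  qed
  moreover have "norm (1 / falling w x R) = (\<Prod>a<?n. norm (1 / (1 - of_nat a * x)))"
    by (simp add: falling_def norm_divide prod_dividef prod_norm)
  ultimately have "norm (1 / falling w x R) \<le> (\<Prod>a<?n. exp (4 / 3 * (real a * X)))"
    by (simp only:) (intro prod_mono, auto)
  also have "\<dots> = exp (4 / 3 * ((\<Sum>a<?n. real a) * X))"
    by (simp only: exp_sum[symmetric] sum_distrib_right sum_distrib_left finite_lessThan)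
  also have "\<dots> \<le> exp (2 / 3 * (X * (real ?n)\<^sup>2))"
    using mult_right_mono[OF sum_lessThan_le_square[of ?n] X] by (simp add: mult_ac)
  finally show ?thesis .
qed

lemma sum_square_le_square_sum:
  fixes f :: "'a \<Rightarrow> real"
  assumes "\<And>i. i \<in> A \<Longrightarrow> 0 \<le> f i"
  shows "(\<Sum>i\<in>A. (f i)\<^sup>2) \<le> (\<Sum>i\<in>A. f i)\<^sup>2"
proof (cases "finite A")
  case True
  have "(\<Sum>i\<in>A. (f i)\<^sup>2) \<le> (\<Sum>i\<in>A. f i * (\<Sum>i\<in>A. f i))"
    unfolding power2_eq_square
    using True assms by (intro sum_mono mult_left_mono member_le_sum) auto
  then show ?thesis by (simp add: power2_eq_square sum_distrib_right)
qed simp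

lemma sum_square_weights_le:
  assumes "\<And>t. t \<in> R \<Longrightarrow> (\<Sum>j\<in>J. m j t) \<le> \<omega> t"
  shows "(\<Sum>j\<in>J. (real (\<Sum>t\<in>R. m j t))\<^sup>2) \<le> (real (\<Sum>t\<in>R. \<omega> t))\<^sup>2"
proof -
  have "(\<Sum>j\<in>J. (real (\<Sum>t\<in>R. m j t))\<^sup>2) \<le> (\<Sum>j\<in>J. real (\<Sum>t\<in>R. m j t))\<^sup>2"
    by (rule sum_square_le_square_sum) (simp del: of_nat_sum)
  also have "(\<Sum>j\<in>J. real (\<Sum>t\<in>R. m j t)) = real (\<Sum>t\<in>R. \<Sum>j\<in>J. m j t)"
    unfolding of_nat_sum by (rule sum.swap)
  also have "\<dots>\<^sup>2 \<le> (real (\<Sum>t\<in>R. \<omega> t))\<^sup>2"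
    using assms by (intro power_mono of_nat_mono sum_mono) (auto simp del: of_nat_sum)
  finally show ?thesis .
qed

text \<open>The denominators contribute 2/3 to the exponent and the numerators 1/2. As the sum of
  the squared weights is at most the square of their sum, the numbers of factors do not enter. The
  case \<open>K = {}\<close> is kept apart because it leads to the smaller constant of the second
  claim.\<close>

lemma norm_moment_ratio_le:
  fixes x y :: complex
  assumes "finite J" "norm x \<le> X" "norm y \<le> X" "X * (real (\<Sum>t\<in>R. \<omega> t))\<^sup>2 \<le> 1"
    and mw: "\<And>t. t \<in> R \<Longrightarrow> (\<Sum>j\<in>J. m j t) \<le> \<omega> t"
    and kw: "\<And>t. t \<in> R \<Longrightarrow> (\<Sum>i\<in>K. k i t) \<le> \<omega> t"
  shows "norm (moment_ratio J m K k x y R) \<le> 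
    exp ((2 / 3 + (if K = {} then 0 else 1 / 2)) * (X * (real (\<Sum>t\<in>R. \<omega> t))\<^sup>2))"
proof -
  let ?W = "real (\<Sum>t\<in>R. \<omega> t)"
  have X: "0 \<le> X" using assms(2) norm_ge_zero order_trans by blast
  have "norm (\<Prod>i\<in>K. falling (k i) y R) \<le> (\<Prod>i\<in>K. exp (X * (real (\<Sum>t\<in>R. k i t))\<^sup>2 / 2))"
    unfolding prod_norm[symmetric] using norm_falling_le[OF assms(3)] by (intro prod_mono) auto
  also have "\<dots> \<le> exp ((if K = {} then 0 else 1 / 2) * (X * ?W\<^sup>2))"
  proof (cases "finite K \<and> K \<noteq> {}")
    case True
    then have "(\<Prod>i\<in>K. exp (X * (real (\<Sum>t\<in>R. k i t))\<^sup>2 / 2)) = 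
        exp (1 / 2 * (X * (\<Sum>i\<in>K. (real (\<Sum>t\<in>R. k i t))\<^sup>2)))"
      by (simp add: exp_sum[symmetric] sum_distrib_left sum_divide_distrib del: of_nat_sum)
    also have "\<dots> \<le> exp (1 / 2 * (X * ?W\<^sup>2))"
      unfolding exp_le_cancel_iff using sum_square_weights_le[OF kw] X by (intro mult_left_mono) auto
    finally show ?thesis using True by simp
  next
    case False
    then show ?thesis using X by auto
  qed
  finally have B: "norm (\<Prod>i\<in>K. falling (k i) y R) \<le> exp ((if K = {} then 0 else 1 / 2) * (X * ?W\<^sup>2))" .
  have "norm (1 / (\<Prod>j\<in>J. falling (m j) x R)) = (\<Prod>j\<in>J. norm (1 / falling (m j) x R))"
    by (simp add: prod_norm norm_divide prod_dividef)
  also have "\<dots> \<le> (\<Prod>j\<in>J. exp (2 / 3 * (X * (real (\<Sum>t\<in>R. m j t))\<^sup>2)))"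
  proof (intro prod_mono conjI norm_ge_zero norm_inverse_falling_le[OF assms(2)])
    fix j a assume j: "j \<in> J" and a: "a < (\<Sum>t\<in>R. m j t)"
    have "m j t \<le> \<omega> t" if "t \<in> R" for t
      using member_le_sum[of j J "\<lambda>j. m j t"] j assms(1) mw[OF that] by simp
    then have "(\<Sum>t\<in>R. m j t) \<le> (\<Sum>t\<in>R. \<omega> t)" by (rule sum_mono)
    with a show "4 * (real a * X) \<le> 1" using assms(4) X by (intro four_mult_less_le_1[of a "\<Sum>t\<in>R. \<omega> t"]) auto
  qed
  also have "\<dots> = exp (2 / 3 * (X * (\<Sum>j\<in>J. (real (\<Sum>t\<in>R. m j t))\<^sup>2)))"
    using assms(1) by (simp only: exp_sum[symmetric] sum_distrib_left)
  also have "\<dots> \<le> exp (2 / 3 * (X * ?W\<^sup>2))"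
    unfolding exp_le_cancel_iff using sum_square_weights_le[OF mw] X by (intro mult_left_mono) auto
  finally have A: "norm (1 / (\<Prod>j\<in>J. falling (m j) x R)) \<le> exp (2 / 3 * (X * ?W\<^sup>2))" .
  have "norm (moment_ratio J m K k x y R) = norm (\<Prod>i\<in>K. falling (k i) y R) * norm (1 / (\<Prod>j\<in>J. falling (m j) x R))"
    by (simp add: moment_ratio_def norm_divide)
  also have "\<dots> \<le> exp ((if K = {} then 0 else 1 / 2) * (X * ?W\<^sup>2)) * exp (2 / 3 * (X * ?W\<^sup>2))"
    using A B by (intro mult_mono) auto
  also have "\<dots> = exp ((2 / 3 + (if K = {} then 0 else 1 / 2)) * (X * ?W\<^sup>2))"
    by (simp only: exp_add[symmetric] distrib_right add.commute)
  finally show ?thesis .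
qed

text \<open>Mapping each point to a chosen representative of its block gives a function from
  \<open>S\<close> to itself whose fibres are the blocks, so the partition can be recovered from
  it.\<close>

lemma card_partitions_le:
  assumes "finite S"
  shows "card {G. partition_on S G} \<le> card S ^ card S"
proof -
  let ?\<Phi> = "\<lambda>h. (\<lambda>x. {y \<in> S. h y = h x}) ` S"
  have "{G. partition_on S G} \<subseteq> ?\<Phi> ` (S \<rightarrow>\<^sub>E S)"
  proof
    fix G assume "G \<in> {G. partition_on S G}"
    then have G: "\<Union>G = S" "disjoint G" "{} \<notin> G" by (auto simp: partition_on_def)
    define b where "b x = (THE B. B \<in> G \<and> x \<in> B)" for x
    have b: "b x = B" if "x \<in> B" "B \<in> G" for x B
      unfolding b_def using that G(2) by (intro the_equality) (auto simp: disjoint_def)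
    define h where "h = restrict (\<lambda>x. SOME y. y \<in> b x) S"
    have h: "h x \<in> B" "x \<in> S" if "x \<in> B" "B \<in> G" for x B
    proof -
      show "x \<in> S" using that G(1) by auto
      then show "h x \<in> B" using that b[OF that] by (auto simp: h_def intro: someI)
    qed
    have fib: "{y \<in> S. h y = h x} = B" if x: "x \<in> B" "B \<in> G" for x B
    proof (intro set_eqI iffI)
      fix y assume "y \<in> {y \<in> S. h y = h x}"
      then obtain B' where B': "y \<in> B'" "B' \<in> G" "h y = h x" using G(1) by auto
      then have "h x \<in> B'" "h x \<in> B" using h(1)[OF B'(1,2)] h(1)[OF x] by auto
      then have "B = B'" using b x(2) B'(2) by metis
      then show "y \<in> B" using B' by simp
    next
      fix y assume y: "y \<in> B"
      have "h y = h x" using b[OF y x(2)] b[OF x] h(2)[OF y x(2)] h(2)[OF x] by (simp add: h_def)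
      then show "y \<in> {y \<in> S. h y = h x}" using h(2)[OF y x(2)] by simp
    qed
    have "G = ?\<Phi> h"
    proof (intro set_eqI iffI)
      fix B assume B: "B \<in> G"
      then obtain x where x: "x \<in> B" using G(3) by fastforce
      then show "B \<in> ?\<Phi> h" using fib[OF x B] h(2)[OF x B] by blast
    next
      fix B assume "B \<in> ?\<Phi> h"
      then obtain x where x: "x \<in> S" "B = {y \<in> S. h y = h x}" by auto
      then obtain B' where "x \<in> B'" "B' \<in> G" using G(1) by auto
      then show "B \<in> G" using fib x by simp
    qed
    moreover have "h \<in> S \<rightarrow>\<^sub>E S"
    proof (rule PiE_I)
      fix x assume "x \<in> S"
      then obtain B where "x \<in> B" "B \<in> G" using G(1) by auto
      then show "h x \<in> S" using h(1) G(1) by blast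
    qed (simp add: h_def)
    ultimately show "G \<in> ?\<Phi> ` (S \<rightarrow>\<^sub>E S)" by blast
  qed
  then have "card {G. partition_on S G} \<le> card (?\<Phi> ` (S \<rightarrow>\<^sub>E S))"
    using assms by (intro card_mono finite_imageI finite_PiE)
  also have "\<dots> \<le> card (S \<rightarrow>\<^sub>E S)" using assms by (intro card_image_le finite_PiE)
  also have "\<dots> = card S ^ card S" using assms by (simp add: card_PiE)
  finally show ?thesis .
qed

text \<open>With \<open>n = card S\<close>, there are at most \<open>n ^ n\<close> partitions, and
  each coefficient is at most \<open>fact n\<close>, hence at most \<open>n ^ n\<close>; together
  these give the power \<open>2 * n\<close>.\<close>

lemma norm_cum_le:
  fixes f :: "'a set \<Rightarrow> complex"
  assumes "finite S" "S \<noteq> {}"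
    and "\<And>G. partition_on S G \<Longrightarrow> (\<Prod>R\<in>G. norm (f R)) \<le> C"
  shows "norm (cum f S) \<le> real (card S) ^ (2 * card S) * C"
proof -
  let ?n = "card S"
  have n: "0 < ?n" using assms by (simp add: card_gt_0_iff)
  have "partition_on S {S}" using assms(2) by (rule partition_on_space)
  then have "norm (f S) \<le> C" using assms(3)[of "{S}"] by simp
  then have C: "0 \<le> C" using norm_ge_zero order_trans by blast
  have "norm (cum f S) \<le> (\<Sum>G | partition_on S G. real ?n ^ ?n * C)"
    unfolding cum_def
  proof (rule sum_norm_le)
    fix G assume "G \<in> {G. partition_on S G}"
    then have G: "partition_on S G" by simp
    have "card G \<le> ?n"
    proof -
      have "card G \<le> (\<Sum>B\<in>G. card B)"
      proof -
        have "1 \<le> card B" if "B \<in> G" for B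
          using that G assms(1) by (metis One_nat_def Suc_leI Union_upper card_gt_0_iff finite_subset partition_onD1 partition_onD3)
        then have "(\<Sum>B\<in>G. 1) \<le> (\<Sum>B\<in>G. card B)" by (rule sum_mono)
        then show ?thesis by simp
      qed
      also have "\<dots> = ?n" using G assms(1)
        by (intro product_partition[symmetric]) (auto simp: partition_on_def intro: finite_subset[of _ S])
      finally show ?thesis .
    qed
    then have "fact (card G - 1) \<le> (fact ?n :: nat)" by (intro fact_mono) simp
    also have "\<dots> \<le> ?n ^ ?n" using fact_le_power[of ?n, where 'a = nat] by simp
    finally have "(fact (card G - 1) :: real) \<le> real ?n ^ ?n"
      by (metis of_nat_fact of_nat_le_iff of_nat_power)
    then show "norm ((-1) ^ (card G - 1) * fact (card G - 1) * (\<Prod>R\<in>G. f R)) \<le> real ?n ^ ?n * C"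
      unfolding norm_mult prod_norm[symmetric]
      using assms(3)[OF G] C by (simp add: norm_power norm_fact) (intro mult_mono; simp add: prod_nonneg)
  qed
  also have "\<dots> = real (card {G. partition_on S G}) * (real ?n ^ ?n * C)" by simp
  also have "\<dots> \<le> real (?n ^ ?n) * (real ?n ^ ?n * C)"
    using card_partitions_le[OF assms(1)] C by (intro mult_right_mono of_nat_mono) auto
  also have "\<dots> = real ?n ^ (2 * ?n) * C" by (simp add: mult_2 power_add)
  finally show ?thesis .
qed

text \<open>The exponent for each block is quadratic in its weight. The squares over the blocks sum
  to at most the square of the total weight, so one bound serves all partitions.\<close>

lemma norm_cum_moment_ratio_le:
  fixes x y :: complex
  assumes S: "finite S" "S \<noteq> {}" and J: "finite J"
    and xy: "norm x \<le> X" "norm y \<le> X" and X: "X * (real (\<Sum>t\<in>S. \<omega> t))\<^sup>2 \<le> 1"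
    and mw: "\<And>t. t \<in> S \<Longrightarrow> (\<Sum>j\<in>J. m j t) \<le> \<omega> t"
    and kw: "\<And>t. t \<in> S \<Longrightarrow> (\<Sum>i\<in>K. k i t) \<le> \<omega> t"
  shows "norm (cum (moment_ratio J m K k x y) S) \<le> 
    real (card S) ^ (2 * card S) * exp (2 / 3 + (if K = {} then 0 else 1 / 2))"
proof (rule norm_cum_le[OF S])
  fix G assume G: "partition_on S G"
  let ?c = "2 / 3 + (if K = {} then 0 else 1 / 2) :: real"
  let ?W = "\<lambda>R. real (\<Sum>t\<in>R. \<omega> t)"
  have X0: "0 \<le> X" using xy(1) norm_ge_zero order_trans by blast
  have finG: "finite G" using S(1) G by (rule finite_elements)
  have fin: "finite R" and sub: "R \<subseteq> S" if "R \<in> G" for R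
    using that S(1) partition_onD1[OF G] by (auto intro: finite_subset)
  have "(\<Prod>R\<in>G. norm (moment_ratio J m K k x y R)) \<le> (\<Prod>R\<in>G. exp (?c * (X * (?W R)\<^sup>2)))"
  proof (intro prod_mono conjI norm_ge_zero norm_moment_ratio_le J xy)
    fix R assume R: "R \<in> G"
    have "(?W R)\<^sup>2 \<le> (?W S)\<^sup>2"
      using sub[OF R] S(1) by (intro power_mono of_nat_mono sum_mono2) (auto simp del: of_nat_sum)
    then show "X * (?W R)\<^sup>2 \<le> 1" using X mult_left_mono[OF _ X0] order_trans by blast
  qed (use sub mw kw in blast)+
  also have "\<dots> = exp (?c * (X * (\<Sum>R\<in>G. (?W R)\<^sup>2)))"
    using finG by (simp only: exp_sum[symmetric] sum_distrib_left)
  also have "\<dots> \<le> exp (?c * 1)"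
  proof -
    have "(\<Sum>R\<in>G. (?W R)\<^sup>2) \<le> (\<Sum>R\<in>G. ?W R)\<^sup>2" by (rule sum_square_le_square_sum) (simp del: of_nat_sum)
    also have "(\<Sum>R\<in>G. ?W R) = ?W S"
    proof -
      have "(\<Sum>t\<in>\<Union>G. \<omega> t) = (\<Sum>R\<in>G. \<Sum>t\<in>R. \<omega> t)"
        using fin partition_onD2[OF G] by (subst sum.Union_disjoint) (auto simp: disjoint_def)
      then show ?thesis using partition_onD1[OF G] by simp
    qed
    finally have "X * (\<Sum>R\<in>G. (?W R)\<^sup>2) \<le> X * (?W S)\<^sup>2" using X0 by (rule mult_left_mono)
    with X have "X * (\<Sum>R\<in>G. (?W R)\<^sup>2) \<le> 1" by linarith
    then show ?thesis unfolding exp_le_cancel_iff by (intro mult_left_mono) auto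
  qed
  finally show "(\<Prod>R\<in>G. norm (moment_ratio J m K k x y R)) \<le> exp ?c" by simp
qed

lemma holomorphic_on_cum_moment_ratio:
  assumes "finite S" "\<alpha> holomorphic_on U" "\<beta> holomorphic_on U"
    and "\<And>z j a. z \<in> U \<Longrightarrow> j \<in> J \<Longrightarrow> a < (\<Sum>t\<in>S. m j t) \<Longrightarrow> of_nat a * \<alpha> z \<noteq> 1"
  shows "(\<lambda>z. cum (moment_ratio J m K k (\<alpha> z) (\<beta> z)) S) holomorphic_on U"
  unfolding cum_def moment_ratio_def falling_def
proof (intro holomorphic_intros assms)
  fix G R z assume G: "G \<in> {G. partition_on S G}" and R: "R \<in> G" and z: "z \<in> U"
  have "(\<Sum>t\<in>R. m j t) \<le> (\<Sum>t\<in>S. m j t)" for j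
    using G R assms(1) by (intro sum_mono2) (auto simp: partition_on_def)
  then have "1 - of_nat a * \<alpha> z \<noteq> 0" if "j \<in> J" "a < (\<Sum>t\<in>R. m j t)" for j a
    using assms(4)[OF z that(1), of a] that(2) by (metis eq_iff_diff_eq_0 order_less_le_trans)
  then show "(\<Prod>j\<in>J. \<Prod>a<(\<Sum>t\<in>R. m j t). 1 - of_nat a * \<alpha> z) \<noteq> 0"
    by (cases "finite J") (auto simp: prod_zero_iff)
qed

lemma of_real_cum: "of_real (cum f S) = cum (\<lambda>R. of_real (f R) :: complex) S"
  by (simp add: cum_def)

lemma of_real_moment_ratio:
  "of_real (moment_ratio J m K k x y R) = (moment_ratio J m K k (of_real x) (of_real y) R :: complex)"
  by (simp add: moment_ratio_def falling_def)

text \<open>In the application \<open>\<omega> t\<close> is the cardinality of \<open>I t\<close>,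
  \<open>X\<close> is the inverse square of \<open>L\<close>, and \<open>p\<close> sends an index to
  its connected component.\<close>

lemma cum_moment_ratio_le:
  fixes u v X :: real
  assumes S: "finite S" "S \<noteq> {}" and J: "finite J" and K: "finite K"
    and X: "X * (real (\<Sum>t\<in>S. \<omega> t))\<^sup>2 \<le> 1" "0 \<le> X"
    and u: "0 \<le> u" "u \<le> 1" and v: "0 \<le> v" "v \<le> 1"
    and mw: "\<And>t. t \<in> S \<Longrightarrow> (\<Sum>j\<in>J. m j t) \<le> \<omega> t"
    and kw: "\<And>t. t \<in> S \<Longrightarrow> (\<Sum>i\<in>K. k i t) \<le> \<omega> t"
    and p: "\<And>i s t. i \<in> K \<Longrightarrow> s \<in> S \<Longrightarrow> t \<in> S \<Longrightarrow> k i s \<noteq> 0 \<Longrightarrow> k i t \<noteq> 0 \<Longrightarrow> p s = p t"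
  shows "\<bar>cum (moment_ratio J m K k (X * v * u) (X * v)) S\<bar> \<le> 
    real (card S) ^ (2 * card S) * exp (2 / 3 + (if K = {} then 0 else 1 / 2)) * 
      v ^ (card S - 1) * u ^ (card (p ` S) - 1)"
proof -
  let ?F = "\<lambda>w z. cum (moment_ratio J m K k (of_real X * w * z) (of_real X * w)) S :: complex"
  define C where "C = real (card S) ^ (2 * card S) * exp (2 / 3 + (if K = {} then 0 else 1 / 2))"
  \<comment> \<open>The radius 2 gives holomorphy on a neighbourhood of the closed unit disc, hence
    continuity up to its boundary; the quantity is then at most 1/2.\<close>
  have small: "norm (of_nat a * (of_real X * w * z)) < 1" 
    if "norm (w * z) \<le> 2" "a < (\<Sum>t\<in>S. l t)" and l: "\<And>t. t \<in> S \<Longrightarrow> l t \<le> \<omega> t"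
    for w z :: complex and a l
  proof -
    have "(\<Sum>t\<in>S. l t) \<le> (\<Sum>t\<in>S. \<omega> t)" using l by (rule sum_mono)
    then have "4 * (real a * X) \<le> 1" using that(2) X by (intro four_mult_less_le_1[of a "\<Sum>t\<in>S. \<omega> t"]) auto
    moreover have "real a * X * norm (w * z) \<le> real a * X * 2"
      using that(1) X by (intro mult_left_mono) auto
    ultimately show ?thesis using X by (simp add: norm_mult mult_ac)
  qed
  have mle: "m j t \<le> \<omega> t" if "j \<in> J" "t \<in> S" for j t
    using member_le_sum[of j J "\<lambda>j. m j t"] that(1) J mw[OF that(2)] by simp
  have kle: "k i t \<le> \<omega> t" if "i \<in> K" "t \<in> S" for i t
    using member_le_sum[of i K "\<lambda>i. k i t"] that(1) K kw[OF that(2)] by simp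
  have bound: "norm (?F w z) \<le> C" if "norm w \<le> 1" "norm z \<le> 1" for w z
    unfolding C_def
  proof (rule norm_cum_moment_ratio_le[OF S J _ _ X(1) mw kw])
    show "norm (of_real X * w) \<le> X"
      using that X by (simp add: norm_mult mult_left_le)
    then show "norm (of_real X * w * z) \<le> X"
      using that(2) by (simp add: norm_mult) (meson mult_left_le mult_nonneg_nonneg norm_ge_zero abs_ge_zero order_trans)
  qed
  have step: "norm (?F w (of_real u)) \<le> C * u ^ (card (p ` S) - 1)" if w: "norm w \<le> 1" for w
  proof -
    have hol: "?F w holomorphic_on ball 0 2"
    proof (rule holomorphic_on_cum_moment_ratio[where \<alpha> = "\<lambda>z. of_real X * w * z" and \<beta> = "\<lambda>_. of_real X * w"])
      fix z :: complex and j a assume z: "z \<in> ball 0 2" and j: "j \<in> J" and a: "a < (\<Sum>t\<in>S. m j t)"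
      have "norm (w * z) \<le> 1 * 2" unfolding norm_mult using w z by (intro mult_mono) auto
      then show "of_nat a * (of_real X * w * z) \<noteq> 1" using small[OF _ a mle[OF j], of w z] by auto
    qed (use S in \<open>auto intro!: holomorphic_intros\<close>)
    have O: "?F w \<in> O[at 0](\<lambda>z. z ^ (card (p ` S) - 1))"
    proof (rule cum_moment_ratio_bigo_components[OF S K _ p])
      fix i a assume i: "i \<in> K" and a: "a < (\<Sum>t\<in>S. k i t)"
      show "of_nat a * (of_real X * w) \<noteq> 1" using small[OF _ a kle[OF i], of w 1] w by auto
    qed
    have "norm (?F w (of_real u)) \<le> C * norm (of_real u :: complex) ^ (card (p ` S) - 1)"
    proof (rule Schwarz_power[OF _ _ _ O])
      show "?F w holomorphic_on ball 0 1" by (rule holomorphic_on_subset[OF hol]) auto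
      show "continuous_on (cball 0 1) (?F w)" 
        by (rule continuous_on_subset[OF holomorphic_on_imp_continuous_on[OF hol]]) auto
    qed (use bound w u in auto)
    then show ?thesis using u by simp
  qed
  \<comment> \<open>The previous bound is uniform over complex \<open>w\<close> in the closed disc,
    so it can serve as the constant in the second application of the Schwarz lemma.\<close>
  have "norm (?F (of_real v) (of_real u)) \<le> C * u ^ (card (p ` S) - 1) * norm (of_real v :: complex) ^ (card S - 1)"
  proof (rule Schwarz_power[where f = "\<lambda>w. ?F w (of_real u)"])
    have hol: "(\<lambda>w. ?F w (of_real u)) holomorphic_on ball 0 2"
    proof (rule holomorphic_on_cum_moment_ratio[where \<alpha> = "\<lambda>w. of_real X * w * of_real u" and \<beta> = "\<lambda>w. of_real X * w"])
      fix w :: complex and j a assume w: "w \<in> ball 0 2" and j: "j \<in> J" and a: "a < (\<Sum>t\<in>S. m j t)"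
      have "norm (w * of_real u) \<le> 2 * 1" unfolding norm_mult using w u by (intro mult_mono) auto
      then show "of_nat a * (of_real X * w * of_real u) \<noteq> 1" using small[OF _ a mle[OF j], of w "of_real u"] by auto
    qed (use S in \<open>auto intro!: holomorphic_intros\<close>)
    show "(\<lambda>w. ?F w (of_real u)) holomorphic_on ball 0 1" by (rule holomorphic_on_subset[OF hol]) auto
    show "continuous_on (cball 0 1) (\<lambda>w. ?F w (of_real u))" 
      by (rule continuous_on_subset[OF holomorphic_on_imp_continuous_on[OF hol]]) auto
    have "of_real X * w * of_real u = of_real X * of_real u * w" for w :: complex by simp
    then show "(\<lambda>w. ?F w (of_real u)) \<in> O[at 0](\<lambda>w. w ^ (card S - 1))"
      using cum_moment_ratio_bigo_scaled[OF S K, of J m k "of_real X * of_real u" "of_real X"] by (simp only:)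
  qed (use step v in auto)
  also have "?F (of_real v) (of_real u) = of_real (cum (moment_ratio J m K k (X * v * u) (X * v)) S)"
    by (simp add: of_real_cum of_real_moment_ratio)
  finally show ?thesis using v by (simp add: C_def mult_ac)
qed

section \<open>From weights back to sets and random variables\<close>

lemma falling_eq_prod: "falling w x R = (\<Prod>a=1..(\<Sum>t\<in>R. w t) - 1. 1 - of_nat a * x)"
proof (cases "\<Sum>t\<in>R. w t")
  case (Suc n)
  have "{..<Suc n} = insert 0 {1..n}" by auto
  with Suc show ?thesis by (simp add: falling_def)
qed (simp add: falling_def)

text \<open>Every partition covers each point once, so all its terms carry the same factor. This
  extracts \<open>\<eta> ^ L\<close>.\<close>

lemma cum_prod_mult:
  assumes "finite S"
  shows "cum (\<lambda>R. (\<Prod>t\<in>R. w t) * f R) S = (\<Prod>t\<in>S. w t) * cum f S"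
  unfolding cum_def sum_distrib_left
proof (rule sum.cong[OF refl])
  fix G assume "G \<in> {G. partition_on S G}"
  then have G: "partition_on S G" by simp
  have "(\<Prod>t\<in>\<Union>G. w t) = (\<Prod>R\<in>G. \<Prod>t\<in>R. w t)"
    using partition_onD1[OF G] partition_onD2[OF G] assms
    by (subst prod.Union_disjoint) (auto simp: disjoint_def intro: finite_subset)
  then show "(-1) ^ (card G - 1) * fact (card G - 1) * (\<Prod>R\<in>G. (\<Prod>t\<in>R. w t) * f R) =
      (\<Prod>t\<in>S. w t) * ((-1) ^ (card G - 1) * fact (card G - 1) * (\<Prod>R\<in>G. f R))"
    using partition_onD1[OF G] by (simp add: prod.distrib mult_ac)
qed

lemma card_UN_Int:
  assumes "finite R" "\<And>t. t \<in> R \<Longrightarrow> finite (I t)" "disjoint_family_on I R"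
  shows "card ((\<Union>t\<in>R. I t) \<inter> C) = (\<Sum>t\<in>R. card (I t \<inter> C))"
proof -
  have "(\<Union>t\<in>R. I t) \<inter> C = (\<Union>t\<in>R. I t \<inter> C)" by auto
  also have "card \<dots> = (\<Sum>t\<in>R. card (I t \<inter> C))"
    using assms by (intro card_UN_disjoint) (auto simp: disjoint_family_on_def)
  finally show ?thesis .
qed

lemma sum_card_Int_le:
  assumes "finite X" "finite J" "disjoint_family_on A J"
  shows "(\<Sum>j\<in>J. card (X \<inter> A j)) \<le> card X"
proof -
  have "(\<Sum>j\<in>J. card (X \<inter> A j)) = card (\<Union>j\<in>J. X \<inter> A j)"
    using assms by (intro card_UN_disjoint[symmetric]) (auto simp: disjoint_family_on_def)
  also have "\<dots> \<le> card X" using assms by (intro card_mono) auto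
  finally show ?thesis .
qed

theorem lemma3p1:
  fixes n l q r L :: nat
    and I A B :: "nat \<Rightarrow> nat set"
    and \<eta> x\<^sub>0 y\<^sub>0 :: real
    and M :: "'w measure"
    and Z :: "nat \<Rightarrow> 'w \<Rightarrow> real"
  assumes "n \<ge> 1" and "l \<ge> 1"
    and "\<forall>t\<in>{1..l}. I t \<subseteq> {1..n}" and "disjoint_family_on I {1..l}"
    and "\<forall>j\<in>{1..q}. A j \<subseteq> {1..n}" and "disjoint_family_on A {1..q}"
    and "\<forall>i\<in>{1..r}. B i \<subseteq> {1..n}" and "disjoint_family_on B {1..r}"
    and L: "L = card (\<Union>t\<in>{1..l}. I t)"
    and "\<eta> > 0" and "x\<^sub>0 > 0" and "y\<^sub>0 > 0"
    and "prob_space M"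
    and "\<forall>t\<in>{1..l}. Z t \<in> borel_measurable M"
    and "\<forall>\<Delta>\<subseteq>{1..l}. integrable M (\<lambda>\<omega>. \<Prod>t\<in>\<Delta>. Z t \<omega>)"
    and moments: "\<forall>\<Delta>\<subseteq>{1..l}.
      prob_space.expectation M (\<lambda>\<omega>. \<Prod>t\<in>\<Delta>. Z t \<omega>) =
        \<eta> ^ card (\<Union>t\<in>\<Delta>. I t) *
        (\<Prod>j=1..q. \<Prod>a=1..card ((\<Union>t\<in>\<Delta>. I t) \<inter> A j) - 1. 1 / (1 - real a * x\<^sub>0)) *
        (\<Prod>i=1..r. \<Prod>a=1..card ((\<Union>t\<in>\<Delta>. I t) \<inter> B i) - 1. (1 - real a * y\<^sub>0))"
  shows "(r \<ge> 1 \<and> 2 * (real L)\<^sup>2 * y\<^sub>0 \<le> 1 \<and> 2 * x\<^sub>0 \<le> y\<^sub>0 \<longrightarrow>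
           \<bar>joint_cumulant M l Z\<bar> \<le>
             4 * real l ^ (2 * l) * \<eta> ^ L * ((real L)\<^sup>2 * y\<^sub>0) ^ (l - 1) *
             (x\<^sub>0 / y\<^sub>0) ^ (num_components {1..l} (sharing_edges l r I B) - 1)) \<and>
         (r = 0 \<and> 2 * (real L)\<^sup>2 * x\<^sub>0 \<le> 1 \<longrightarrow>
           \<bar>joint_cumulant M l Z\<bar> \<le>
             2 * real l ^ (2 * l) * \<eta> ^ L * ((real L)\<^sup>2 * x\<^sub>0) ^ (l - 1))"
proof -
  let ?S = "{1..l}"
  let ?\<omega> = "\<lambda>t. card (I t)"
  let ?m = "\<lambda>j t. card (I t \<inter> A j)" and ?k = "\<lambda>i t. card (I t \<inter> B i)"
  let ?f = "moment_ratio {1..q} ?m {1..r} ?k"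
  \<comment> \<open>\<open>?p t\<close> is the connected component of \<open>t\<close>, so the image
    of \<open>?S\<close> under \<open>?p\<close> is the set of components.\<close>
  let ?p = "\<lambda>t. (sharing_edges l r I B \<inter> ?S \<times> ?S)\<^sup>* `` {t}"
  have S: "finite ?S" "?S \<noteq> {}" and cardS: "card ?S = l" using \<open>l \<ge> 1\<close> by auto
  have finI: "finite (I t)" if "t \<in> ?S" for t
    using assms(3) that finite_subset by blast
  have cardU: "card ((\<Union>t\<in>R. I t) \<inter> C) = (\<Sum>t\<in>R. card (I t \<inter> C))" if "R \<subseteq> ?S" for R C
  proof (rule card_UN_Int)
    show "finite R" using that finite_subset by blast
    show "disjoint_family_on I R" using disjoint_family_on_mono[OF that assms(4)] .
  qed (use finI that in blast)
  have cardU': "card (\<Union>t\<in>R. I t) = (\<Sum>t\<in>R. card (I t))" if "R \<subseteq> ?S" for R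
    using cardU[OF that, of UNIV] by simp
  have L': "L = (\<Sum>t\<in>?S. ?\<omega> t)" using L cardU' by simp
  have mw: "(\<Sum>j\<in>{1..q}. ?m j t) \<le> ?\<omega> t" if "t \<in> ?S" for t
    using finI[OF that] assms(6) by (intro sum_card_Int_le) auto
  have kw: "(\<Sum>i\<in>{1..r}. ?k i t) \<le> ?\<omega> t" if "t \<in> ?S" for t
    using finI[OF that] assms(8) by (intro sum_card_Int_le) auto
  have p: "?p s = ?p t" 
    if "i \<in> {1..r}" "s \<in> ?S" "t \<in> ?S" "?k i s \<noteq> 0" "?k i t \<noteq> 0" for i s t
  proof -
    let ?r = "sharing_edges l r I B \<inter> ?S \<times> ?S"
    have "sym ?r" unfolding sym_def sharing_edges_def by blast
    then have "equiv UNIV (?r\<^sup>*)" by (intro equivI refl_rtrancl sym_rtrancl trans_rtrancl) auto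
    moreover have "(s, t) \<in> ?r\<^sup>*"
    proof (cases "s = t")
      case False
      have "I s \<inter> B i \<noteq> {}" "I t \<inter> B i \<noteq> {}" using that(4,5) by auto
      then have "(s, t) \<in> ?r" using that(1-3) False unfolding sharing_edges_def by blast
      then show ?thesis by blast
    qed simp
    ultimately show ?thesis by (rule equiv_class_eq)
  qed
  have comps: "card (?p ` ?S) = num_components ?S (sharing_edges l r I B)"
    unfolding num_components_def quotient_def by (rule arg_cong[where f = card]) auto
  have "prob_space.expectation M (\<lambda>\<omega>. \<Prod>t\<in>R. Z t \<omega>) = (\<Prod>t\<in>R. \<eta> ^ ?\<omega> t) * ?f x\<^sub>0 y\<^sub>0 R" if "R \<subseteq> ?S" for R
  proof -
    have "prob_space.expectation M (\<lambda>\<omega>. \<Prod>t\<in>R. Z t \<omega>) = 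
        (\<Prod>t\<in>R. \<eta> ^ ?\<omega> t) * (\<Prod>j=1..q. 1 / falling (?m j) x\<^sub>0 R) * (\<Prod>i=1..r. falling (?k i) y\<^sub>0 R)"
      using moments[rule_format, OF that] that 
      by (simp add: cardU cardU' power_sum falling_eq_prod prod_dividef)
    then show ?thesis by (simp add: moment_ratio_def prod_dividef)
  qed
  then have "joint_cumulant M l Z = cum (\<lambda>R. (\<Prod>t\<in>R. \<eta> ^ ?\<omega> t) * ?f x\<^sub>0 y\<^sub>0 R) ?S"
    by (subst cum_cong[symmetric, where f = "\<lambda>R. prob_space.expectation M (\<lambda>\<omega>. \<Prod>t\<in>R. Z t \<omega>)"]) (simp_all add: joint_cumulant_def cum_def)
  then have cum: "\<bar>joint_cumulant M l Z\<bar> = \<eta> ^ L * \<bar>cum (?f x\<^sub>0 y\<^sub>0) ?S\<bar>"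
    using \<open>\<eta> > 0\<close> by (simp add: cum_prod_mult L' power_sum abs_mult abs_prod)
  \<comment> \<open>For \<open>L = 0\<close> this is \<open>1 / 0 = 0\<close>, and the two bounds on
    \<open>X\<close> remain true.\<close>
  define X where "X = 1 / (real L)\<^sup>2"
  have X: "X * (real (\<Sum>t\<in>?S. ?\<omega> t))\<^sup>2 \<le> 1" "0 \<le> X" unfolding X_def L' by auto
  have main: "\<bar>cum (?f (X * v * u) (X * v)) ?S\<bar> \<le>
      real l ^ (2 * l) * exp (2 / 3 + (if r = 0 then 0 else 1 / 2)) * v ^ (l - 1) * u ^ (card (?p ` ?S) - 1)"
    if "0 \<le> u" "u \<le> 1" "0 \<le> v" "v \<le> 1" for u v
  proof -
    have "\<bar>cum (?f (X * v * u) (X * v)) ?S\<bar> \<le> real (card ?S) ^ (2 * card ?S) * 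
        exp (2 / 3 + (if {1..r} = {} then 0 else 1 / 2)) * v ^ (card ?S - 1) * u ^ (card (?p ` ?S) - 1)"
    proof (rule cum_moment_ratio_le[OF S finite_atLeastAtMost finite_atLeastAtMost X that mw kw])
      show "?p s = ?p t" 
        if "i \<in> {1..r}" "s \<in> ?S" "t \<in> ?S" "?k i s \<noteq> 0" "?k i t \<noteq> 0" for i s t
        using that by (rule p)
    qed
    moreover have "{1..r} = {} \<longleftrightarrow> r = 0" by auto
    ultimately show ?thesis by (simp only: cardS)
  qed
  have zero: "card (I t) = 0" if "L = 0" "t \<in> ?S" for t
    using that by (simp add: L')
  \<comment> \<open>If \<open>L = 0\<close>, all weights vanish and the ratio is 1 for all
    parameters, so the substitution need not return \<open>x\<^sub>0\<close> and
    \<open>y\<^sub>0\<close>. If \<open>r = 0\<close>, the ratio is free of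
    \<open>y\<close>.\<close>
  have rescale: "cum (?f x\<^sub>0 y\<^sub>0) ?S = cum (?f x y) ?S" 
    if "L \<noteq> 0 \<Longrightarrow> x = x\<^sub>0" "L \<noteq> 0 \<Longrightarrow> r \<noteq> 0 \<Longrightarrow> y = y\<^sub>0" for x y
  proof (cases "L = 0")
    case True
    have "I t \<inter> C = {}" if "t \<in> ?S" for t C
      using zero[OF True that] finI[OF that] by simp
    then have "(\<Sum>t\<in>R. card (I t \<inter> C)) = 0" if "R \<subseteq> ?S" for R C using that by (auto intro!: sum.neutral)
    then show ?thesis by (intro cum_cong) (simp add: moment_ratio_def falling_def)
  next
    case False
    then show ?thesis using that by (cases "r = 0") (auto simp: moment_ratio_def intro!: cum_cong)
  qed
  \<comment> \<open>Cubing reduces the claim to \<open>exp 1 ^ 2 \<le> 8\<close>, which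
    \<open>exp 1 < 2.72\<close> provides.\<close>
  have exp_23: "exp (2 / 3 :: real) \<le> 2"
  proof (rule power_le_imp_le_base)
    have "exp (2 / 3 :: real) ^ Suc 2 = exp 1 ^ 2" by (simp flip: exp_of_nat_mult)
    also have "\<dots> \<le> (272 / 100) ^ 2" using e_less_272 by (intro power_mono) auto
    also have "\<dots> \<le> (2 :: real) ^ Suc 2" by (simp add: power2_eq_square)
    finally show "exp (2 / 3 :: real) ^ Suc 2 \<le> 2 ^ Suc 2" .
  qed simp
  have exp_12: "exp (1 / 2 :: real) \<le> 2"
    by (rule order_trans[OF _ exp_23]) simp
  show ?thesis
  proof (intro conjI impI; elim conjE)
    assume r: "r \<ge> 1" and y: "2 * (real L)\<^sup>2 * y\<^sub>0 \<le> 1" and xy: "2 * x\<^sub>0 \<le> y\<^sub>0"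
    \<comment> \<open>For \<open>L \<noteq> 0\<close> this choice gives
      \<open>X * v * u = x\<^sub>0\<close> and \<open>X * v = y\<^sub>0\<close>.\<close>
    define u v where "u = x\<^sub>0 / y\<^sub>0" and "v = (real L)\<^sup>2 * y\<^sub>0"
    have u: "0 \<le> u" "u \<le> 1" and v: "0 \<le> v" "v \<le> 1"
      using y xy \<open>x\<^sub>0 > 0\<close> \<open>y\<^sub>0 > 0\<close> by (auto simp: u_def v_def)
    have K: "{1..r} \<noteq> {}" using r by simp
    let ?c = "v ^ (l - 1) * u ^ (num_components ?S (sharing_edges l r I B) - 1)"
    have "cum (?f x\<^sub>0 y\<^sub>0) ?S = cum (?f (X * v * u) (X * v)) ?S"
      using \<open>y\<^sub>0 > 0\<close> by (intro rescale) (auto simp: X_def u_def v_def)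
    also have "\<bar>\<dots>\<bar> \<le> real l ^ (2 * l) * exp (2 / 3 + 1 / 2) * v ^ (l - 1) * u ^ (num_components ?S (sharing_edges l r I B) - 1)"
      using main[OF u v] r by (simp only: comps) simp
    also have "\<dots> = real l ^ (2 * l) * (exp (2 / 3) * exp (1 / 2)) * ?c"
      by (simp only: exp_add mult.assoc)
    also have "\<dots> \<le> real l ^ (2 * l) * (2 * 2) * ?c"
      using exp_23 exp_12 u v by (intro mult_right_mono mult_left_mono mult_mono) auto
    finally have "\<eta> ^ L * \<bar>cum (?f x\<^sub>0 y\<^sub>0) ?S\<bar> \<le> \<eta> ^ L * (real l ^ (2 * l) * (2 * 2) * ?c)"
      using \<open>\<eta> > 0\<close> by (intro mult_left_mono) auto
    then show "\<bar>joint_cumulant M l Z\<bar> \<le> 4 * real l ^ (2 * l) * \<eta> ^ L * ((real L)\<^sup>2 * y\<^sub>0) ^ (l - 1) *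
        (x\<^sub>0 / y\<^sub>0) ^ (num_components ?S (sharing_edges l r I B) - 1)"
      unfolding cum u_def[symmetric] v_def[symmetric] by (simp add: mult_ac)
  next
    assume r: "r = 0" and x: "2 * (real L)\<^sup>2 * x\<^sub>0 \<le> 1"
    define v where "v = (real L)\<^sup>2 * x\<^sub>0"
    have v: "0 \<le> v" "v \<le> 1" using x \<open>x\<^sub>0 > 0\<close> by (auto simp: v_def)
    have K: "{1..r} = {}" using r by simp
    \<comment> \<open>With \<open>u = 1\<close> the factor with the component exponent is 1, and
      \<open>v\<close> is now scaled by \<open>x\<^sub>0\<close>. The second argument becomes
      \<open>X * v\<close>, which is allowed because there are no numerators.\<close>
    have "cum (?f x\<^sub>0 y\<^sub>0) ?S = cum (?f (X * v * 1) (X * v)) ?S"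
      using r by (intro rescale) (auto simp: X_def v_def)
    also have "\<bar>\<dots>\<bar> \<le> real l ^ (2 * l) * exp (2 / 3) * v ^ (l - 1)"
      using main[OF zero_le_one order_refl v] r by simp
    also have "\<dots> \<le> real l ^ (2 * l) * 2 * v ^ (l - 1)"
      using exp_23 v by (intro mult_right_mono mult_left_mono) auto
    finally have "\<eta> ^ L * \<bar>cum (?f x\<^sub>0 y\<^sub>0) ?S\<bar> \<le> \<eta> ^ L * (real l ^ (2 * l) * 2 * v ^ (l - 1))"
      using \<open>\<eta> > 0\<close> by (intro mult_left_mono) auto
    then show "\<bar>joint_cumulant M l Z\<bar> \<le> 2 * real l ^ (2 * l) * \<eta> ^ L * ((real L)\<^sup>2 * x\<^sub>0) ^ (l - 1)"
      unfolding cum v_def[symmetric] by (simp add: mult_ac)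
  qed
qed

end
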